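(* Let $X$ be a connected, locally connected, locally compact Hausdorff, non-compact space whose one-point compactification has genus $0$. Let $\nu$ be a signed topological measure on $X$ with finite norm. Then $\nu$ can be represented as a difference of two topological measures on $X$, i.e. there are topological measures $\nu_1,\nu_2$ on $X$ with $\nu=\nu_1-\nu_2$ on $\mathcal{O}(X)\cup\mathcal{C}(X)$.
   Context: $\mathcal{O}(X), \mathcal{C}(X), \mathcal{K}(X)$ denote the families of open, closed, compact subsets of $X$. Set functions into the extended reals are assumed not to be identically $\infty$ or identically $-\infty$. A signed topological measure on $X$ is a set function $\mu:\mathcal{O}(X)\cup\mathcal{C}(X)\to[-\infty,\infty]$ that assumes at most one of $\infty,-\infty$ and satisfies: (1) if $A,B,A\sqcup B\in\mathcal{K}(X)\cup\mathcal{O}(X)$ ($A,B$ disjoint) then $\mu(A\sqcup B)=\mu(A)+\mu(B)$; (2) for $U$ open, $\mu(U)$ is the limit of the net $\mu(K)$ over compact $K\subseteq U$ ordered by inclusion; (3) for $F$ closed, $\mu(F)$ is the limit of the net $\mu(U)$ over open $U\supseteq F$ ordered by reverse inclusion. Its norm is $\|\mu\|=\sup\{|\mu(K)|:K\in\mathcal{K}(X)\}$. A topological measure on $X$ is a set function $\mu:\mathcal{C}(X)\cup\mathcal{O}(X)\to[0,\infty]$ such that: if $A,B,A\sqcup B\in\mathcal{K}(X)\cup\mathcal{O}(X)$ then $\mu(A\sqcup B)=\mu(A)+\mu(B)$; $\mu(U)=\sup\{\mu(K):K\in\mathcal{K}(X),K\subseteq U\}$ for $U$ open; $\mu(F)=\inf\{\mu(U):U\in\mathcal{O}(X),F\subseteq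 U\}$ for $F$ closed. In a compact space, a set is called solid if it and its complement are both connected (the empty set being regarded as connected). A compact space has genus $0$ iff any finite union of disjoint closed solid sets has a connected complement. *)

theory Defs
  imports "HOL-Analysis.Analysis"
begin

text \<open>
  Set functions on the open and closed subsets of a space are represented by total functions on
  all sets; values on sets that are neither open nor closed are never consulted.
\<close>

definition open_or_closed_in :: "'a topology \<Rightarrow> 'a set \<Rightarrow> bool" where
  "open_or_closed_in X A \<longleftrightarrow> openin X A \<or> closedin X A"

definition open_or_compact_in :: "'a topology \<Rightarrow> 'a set \<Rightarrow> bool" where
  "open_or_compact_in X A \<longleftrightarrow> openin X A \<or> compactin X A"

text \<open>
  The section filters of two nets: the compact subsets of \<open>U\<close> directed by inclusion, and the
  open supersets of \<open>F\<close> directed by reverse inclusion.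
\<close>

definition compact_subsets_at_top :: "'a topology \<Rightarrow> 'a set \<Rightarrow> 'a set filter" where
  "compact_subsets_at_top X U =
     (INF K\<in>{K. compactin X K \<and> K \<subseteq> U}. principal {L. compactin X L \<and> K \<subseteq> L \<and> L \<subseteq> U})"

definition open_supersets_at_bot :: "'a topology \<Rightarrow> 'a set \<Rightarrow> 'a set filter" where
  "open_supersets_at_bot X F =
     (INF U\<in>{U. openin X U \<and> F \<subseteq> U}. principal {V. openin X V \<and> F \<subseteq> V \<and> V \<subseteq> U})"

lemma eventually_compact_subsets_at_top:
  "eventually P (compact_subsets_at_top X U) \<longleftrightarrow>
     (\<exists>K. compactin X K \<and> K \<subseteq> U \<and> (\<forall>L. compactin X L \<and> K \<subseteq> L \<and> L \<subseteq> U \<longrightarrow> P L))"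
  unfolding compact_subsets_at_top_def
proof (subst eventually_INF_base, goal_cases)
  case 1
  show ?case using compactin_empty by blast
next
  case (2 K L)
  then show ?case by (intro bexI[of _ "K \<union> L"]) (auto intro: compactin_Un)
qed (auto simp: eventually_principal)

lemma eventually_open_supersets_at_bot:
  assumes "F \<subseteq> topspace X"
  shows "eventually P (open_supersets_at_bot X F) \<longleftrightarrow>
     (\<exists>U. openin X U \<and> F \<subseteq> U \<and> (\<forall>V. openin X V \<and> F \<subseteq> V \<and> V \<subseteq> U \<longrightarrow> P V))"
  unfolding open_supersets_at_bot_def
proof (subst eventually_INF_base, goal_cases)
  case 1
  show ?case using assms by blast
next
  case (2 U V)
  then show ?case by (intro bexI[of _ "U \<inter> V"]) auto
qed (auto simp: eventually_principal)

definition signed_topological_measure :: "'a topology \<Rightarrow> ('a set \<Rightarrow> ereal) \<Rightarrow> bool" where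
  "signed_topological_measure X \<mu> \<longleftrightarrow>
     (\<exists>A. open_or_closed_in X A \<and> \<mu> A \<noteq> \<infinity>) \<and>
     (\<exists>A. open_or_closed_in X A \<and> \<mu> A \<noteq> -\<infinity>) \<and>
     \<not> ((\<exists>A. open_or_closed_in X A \<and> \<mu> A = \<infinity>) \<and> (\<exists>A. open_or_closed_in X A \<and> \<mu> A = -\<infinity>)) \<and>
     (\<forall>A B. open_or_compact_in X A \<and> open_or_compact_in X B \<and> open_or_compact_in X (A \<union> B) \<and>
        disjnt A B \<longrightarrow> \<mu> (A \<union> B) = \<mu> A + \<mu> B) \<and>
     (\<forall>U. openin X U \<longrightarrow> (\<mu> \<longlongrightarrow> \<mu> U) (compact_subsets_at_top X U)) \<and>
     (\<forall>F. closedin X F \<longrightarrow> (\<mu> \<longlongrightarrow> \<mu> F) (open_supersets_at_bot X F))"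

definition signed_topological_measure_norm :: "'a topology \<Rightarrow> ('a set \<Rightarrow> ereal) \<Rightarrow> ereal" where
  "signed_topological_measure_norm X \<mu> = (SUP K\<in>{K. compactin X K}. \<bar>\<mu> K\<bar>)"

definition topological_measure :: "'a topology \<Rightarrow> ('a set \<Rightarrow> ereal) \<Rightarrow> bool" where
  "topological_measure X \<mu> \<longleftrightarrow>
     (\<forall>A. open_or_closed_in X A \<longrightarrow> 0 \<le> \<mu> A) \<and>
     (\<exists>A. open_or_closed_in X A \<and> \<mu> A \<noteq> \<infinity>) \<and>
     (\<forall>A B. open_or_compact_in X A \<and> open_or_compact_in X B \<and> open_or_compact_in X (A \<union> B) \<and>
        disjnt A B \<longrightarrow> \<mu> (A \<union> B) = \<mu> A + \<mu> B) \<and>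
     (\<forall>U. openin X U \<longrightarrow> \<mu> U = (SUP K\<in>{K. compactin X K \<and> K \<subseteq> U}. \<mu> K)) \<and>
     (\<forall>F. closedin X F \<longrightarrow> \<mu> F = (INF U\<in>{U. openin X U \<and> F \<subseteq> U}. \<mu> U))"

text \<open>
  The next two notions are intended for compact spaces. The empty set counts as connected.
\<close>

definition solid_in :: "'a topology \<Rightarrow> 'a set \<Rightarrow> bool" where
  "solid_in X A \<longleftrightarrow> connectedin X A \<and> connectedin X (topspace X - A)"

definition genus_zero :: "'a topology \<Rightarrow> bool" where
  "genus_zero X \<longleftrightarrow>
     (\<forall>\<C>. finite \<C> \<and> (\<forall>C\<in>\<C>. closedin X C \<and> solid_in X C) \<and> pairwise disjnt \<C> \<longrightarrow>
        connectedin X (topspace X - \<Union>\<C>))"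

end

theory Submission
  imports Defs
begin

text \<open>
  Let \<open>Y\<close> be the one-point compactification of \<open>X\<close>. The positive variation
  \<open>p(A) = inf {sup {\<nu>(K) | K \<subseteq> V compact} | V \<supseteq> A open}\<close> and the negative variation \<open>n\<close> satisfy
  \<open>\<nu> = p - n\<close> on open and compact sets, and they are superadditive and regular. In general they are
  not additive. The idea is to keep their values only on solid sets, where genus zero leaves hardly
  any additivity to check, and to build topological measures from these values.

  With the point at infinity as base point, \<open>p\<close> is replaced by the weight \<open>\<lambda>\<close> on \<open>Y\<close> that agrees with
  \<open>p\<close> on sets without infinity and is \<open>p(X) - p(Y - A)\<close> on sets \<open>A\<close> that contain it. This
  weight is still superadditive and regular, and \<open>\<lambda>(A) + \<lambda>(Y - A) = \<lambda>(Y)\<close>. A topological measure that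
  extends \<open>\<lambda>\<close> from solid sets must give to a closed connected set \<open>C\<close> the mass \<open>\<lambda>(Y) - \<Sum> \<lambda>(U)\<close>, where
  \<open>U\<close> runs over the components of \<open>Y - C\<close>; these are solid. The measure of an open set is then the
  supremum of the total masses of finite disjoint families of closed connected subsets.

  Superadditivity of this inner measure is immediate. What has to be shown is that nothing is lost
  between a closed set \<open>K\<close> and its complement. Let \<open>N\<close> be closed, connected and contained in an open
  connected set \<open>W\<close> with finitely many solid holes. Each component of \<open>Y - N\<close>, with the holes of \<open>W\<close> in it
  removed, is connected because \<open>Y\<close> has genus zero; so these are the components of \<open>W - N\<close>, and their
  masses add up to the mass of \<open>W\<close> minus the mass of \<open>N\<close> (\<open>mass_has_sum_Diff\<close>). By induction, the masses
  of a finite family and of the components of its complement add up to \<open>\<lambda>(Y)\<close>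
  (\<open>mass_has_sum_complement\<close>). Since such components are exhausted from inside by closed connected
  sets (\<open>mass_le_inner\<close>), and since every closed set is enclosed by finite families inside any given
  neighbourhood, the missing inequality \<open>outer_le_inner\<close> follows.

  For the difference of the two measures, countable additivity of \<open>\<nu>\<close> on disjoint open sets shows
  that the masses built from \<open>p\<close> and \<open>n\<close> differ by \<open>\<nu>(C)\<close> on each compact connected set \<open>C\<close>
  (\<open>mass_difference\<close>). Finite disjoint unions of such sets are cofinal among the compact subsets of an
  open set, and the identity passes to open sets and then to closed sets by taking limits.
\<close>

section \<open>Components of subsets and solid neighbourhoods\<close>

abbreviation comps :: "'a topology \<Rightarrow> 'a set \<Rightarrow> 'a set set" where
  "comps Y A \<equiv> connected_components_of (subtopology Y A)"

lemma Union_comps: "A \<subseteq> topspace Y \<Longrightarrow> \<Union>(comps Y A) = A"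
  by (simp add: Union_connected_components_of inf.absorb2)

lemma compsD:
  assumes "W \<in> comps Y A"
  shows "connectedin Y W" "W \<noteq> {}" "W \<subseteq> A" "W \<subseteq> topspace Y"
  using assms connectedin_connected_components_of[OF assms] nonempty_connected_components_of[OF assms]
  by (auto simp: connectedin_subtopology dest: connectedin_subset_topspace)

lemma comps_maximal:
  assumes "W \<in> comps Y A" "connectedin Y C" "C \<subseteq> A" "C \<inter> W \<noteq> {}"
  shows "C \<subseteq> W"
  using connected_components_of_maximal[OF assms(1), of C] assms
  by (auto simp: connectedin_subtopology disjnt_def)

lemma comps_disjnt: "pairwise disjnt (comps Y A)"
  by (rule pairwise_disjoint_connected_components_of)

lemma comps_superset:
  assumes "connectedin Y C" "C \<noteq> {}" "C \<subseteq> A"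
  obtains W where "W \<in> comps Y A" "C \<subseteq> W"
proof -
  have "subtopology Y A \<noteq> trivial_topology"
    using assms connectedin_subset_topspace[OF assms(1)]
    by (metis connectedin_subset_topspace connectedin_subtopology subset_empty topspace_discrete_topology)
  then show ?thesis
    using exists_connected_component_of_superset[of "subtopology Y A" C] assms that
    by (auto simp: connectedin_subtopology)
qed

lemma openin_comps:
  "locally_connected_space Y \<Longrightarrow> openin Y A \<Longrightarrow> W \<in> comps Y A \<Longrightarrow> openin Y W"
  using locally_connected_space_open_connected_components by blast

text \<open>
  A component that meets a member \<open>U\<close> of the partition contains it, and \<open>U\<close> is clopen in the
  union; so the two coincide.
\<close>

lemma comps_eqI:
  assumes disj: "pairwise disjnt \<U>"
    and \<U>: "\<And>U. U \<in> \<U> \<Longrightarrow> connectedin Y U \<and> U \<noteq> {} \<and> openin (subtopology Y (\<Union>\<U>)) U"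
  shows "comps Y (\<Union>\<U>) = \<U>"
proof -
  have mem: "U \<in> comps Y (\<Union>\<U>)" if U: "U \<in> \<U>" for U
  proof -
    obtain W where W: "W \<in> comps Y (\<Union>\<U>)" "U \<subseteq> W"
      using comps_superset[of Y U "\<Union>\<U>"] \<U>[OF U] U by blast
    have eq: "topspace (subtopology Y (\<Union>\<U>)) - U = \<Union>(\<U> - {U})"
    proof -
      have "\<Union>\<U> \<subseteq> topspace Y" using \<U> connectedin_subset_topspace by blast
      then have "topspace (subtopology Y (\<Union>\<U>)) = \<Union>\<U>" by auto
      then show ?thesis using disj U by (auto simp: pairwise_def disjnt_iff)
    qed
    have "openin (subtopology Y (\<Union>\<U>)) (\<Union>(\<U> - {U}))"
      using \<U> by blast
    then have "closedin (subtopology Y (\<Union>\<U>)) U"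
      using eq \<U>[OF U] openin_subset unfolding closedin_def by metis
    moreover have "connectedin (subtopology Y (\<Union>\<U>)) W"
      by (rule connectedin_connected_components_of[OF W(1)])
    ultimately have "W \<subseteq> U"
      using connectedin_clopen_cases[of "subtopology Y (\<Union>\<U>)" W U] \<U>[OF U] W
      by (auto simp: disjnt_def)
    with W show ?thesis by auto
  qed
  moreover have "W \<in> \<U>" if W: "W \<in> comps Y (\<Union>\<U>)" for W
  proof -
    obtain U where U: "U \<in> \<U>" "U \<inter> W \<noteq> {}"
      using compsD[OF W] by blast
    with mem[OF U(1)] W show ?thesis
      using connected_components_of_overlap by blast
  qed
  ultimately show ?thesis by blast
qed

lemma comps_eqI_open:
  assumes "pairwise disjnt \<U>" "\<And>U. U \<in> \<U> \<Longrightarrow> connectedin Y U \<and> U \<noteq> {} \<and> openin Y U" "A = \<Union>\<U>"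
  shows "comps Y A = \<U>"
  unfolding assms(3) using assms(1,2)
  by (intro comps_eqI) (auto simp: openin_subtopology)

lemma comps_eqI_closed:
  assumes fin: "finite \<U>" and disj: "pairwise disjnt \<U>"
    and \<U>: "\<And>U. U \<in> \<U> \<Longrightarrow> connectedin Y U \<and> U \<noteq> {} \<and> closedin Y U" and A: "A = \<Union>\<U>"
  shows "comps Y A = \<U>"
  unfolding A
proof (rule comps_eqI[OF disj])
  fix U assume U: "U \<in> \<U>"
  have "closedin Y (\<Union>(\<U> - {U}))"
    using fin \<U> by (intro closedin_Union) auto
  then have "openin Y (topspace Y - \<Union>(\<U> - {U}))" by blast
  moreover have "U = (topspace Y - \<Union>(\<U> - {U})) \<inter> \<Union>\<U>"
    using disj U \<U>[OF U] closedin_subset[of Y U] by (auto simp: pairwise_def disjnt_iff)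
  ultimately show "connectedin Y U \<and> U \<noteq> {} \<and> openin (subtopology Y (\<Union>\<U>)) U"
    using \<U>[OF U] unfolding openin_subtopology by blast
qed

text \<open>
  Suppose that \<open>W \<union> B\<close> splits into \<open>P\<close> and \<open>Q\<close> with \<open>W\<close> inside \<open>P\<close>. Then \<open>Q\<close> is a part of \<open>B\<close>, so it
  is separated from \<open>A\<close> as well, and \<open>Q\<close> splits off from the whole space.
\<close>

lemma connectedin_Un_separated_part:
  assumes Y: "connected_space Y" and W: "connectedin Y W"
    and AB: "topspace Y - W = A \<union> B" "separatedin Y A B"
  shows "connectedin Y (W \<union> B)"
proof (rule ccontr)
  assume "\<not> connectedin Y (W \<union> B)"
  moreover have sub: "W \<union> B \<subseteq> topspace Y"
    using connectedin_subset_topspace[OF W] AB by auto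
  ultimately obtain P Q where PQ: "P \<union> Q = W \<union> B" "P \<noteq> {}" "Q \<noteq> {}" "separatedin Y P Q"
    unfolding connectedin_eq_not_separated by blast
  have main: False if "P \<union> Q = W \<union> B" "P \<noteq> {}" "Q \<noteq> {}" "separatedin Y P Q" "W \<subseteq> P" for P Q
  proof -
    have "P \<inter> Q = {}" using that(4) by (meson disjnt_def separatedin_imp_disjoint)
    then have "Q \<subseteq> B" using that by blast
    then have "separatedin Y A Q" using AB(2) separatedin_mono by blast
    then have "separatedin Y (A \<union> P) Q" using that(4) by (simp add: separatedin_Un)
    moreover have "(A \<union> P) \<union> Q = topspace Y"
      using AB that(1) sub connectedin_subset_topspace[OF W] by blast
    ultimately show False
      using Y that unfolding connected_space_eq_not_separated by blast
  qed
  have "W \<subseteq> P \<or> W \<subseteq> Q"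
    using connectedin_subset_separated_union[OF W PQ(4)] PQ(1) by blast
  then show False
    using main[of P Q] main[of Q P] PQ by (auto simp: Un_commute separatedin_sym)
qed

text \<open>
  In a separation \<open>A\<close>, \<open>B\<close> of the complement of \<open>W\<close>, the connected set \<open>C\<close> lies on one side, say in
  \<open>A\<close>. The connected set \<open>W \<union> B\<close> then misses \<open>C\<close>, against the maximality of \<open>W\<close>.
\<close>

lemma connectedin_complement_comp:
  assumes Y: "connected_space Y" and C: "connectedin Y C"
    and W: "W \<in> comps Y (topspace Y - C)"
  shows "connectedin Y (topspace Y - W)"
  unfolding connectedin_eq_not_separated
proof (intro conjI notI)
  assume "\<exists>A B. A \<union> B = topspace Y - W \<and> A \<noteq> {} \<and> B \<noteq> {} \<and> separatedin Y A B"
  then obtain A B where AB: "A \<union> B = topspace Y - W" "A \<noteq> {}" "B \<noteq> {}" "separatedin Y A B" by blast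
  have main: False if AB: "A \<union> B = topspace Y - W" "B \<noteq> {}" "separatedin Y A B" "C \<subseteq> A" for A B
  proof -
    have "connectedin Y (W \<union> B)"
      using connectedin_Un_separated_part[OF Y compsD(1)[OF W]] AB by metis
    moreover have "A \<inter> B = {}" using AB by (meson disjnt_def separatedin_imp_disjoint)
    then have "W \<union> B \<subseteq> topspace Y - C" using compsD[OF W] AB by blast
    ultimately have "W \<union> B \<subseteq> W"
      using comps_maximal[OF W] compsD[OF W] by blast
    then show False using AB by blast
  qed
  have "C \<subseteq> topspace Y - W" using compsD[OF W] connectedin_subset_topspace[OF C] by blast
  then have "C \<subseteq> A \<or> C \<subseteq> B"
    using connectedin_subset_separated_union[OF C AB(4)] AB(1) by blast
  then show False
    using main[of A B] main[of B A] AB by (auto simp: Un_commute separatedin_sym)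
qed auto

text \<open>
  Fix a point \<open>a\<close> of \<open>K\<close>. The points of \<open>G\<close> that share with \<open>a\<close> a connected open set whose closure
  stays in \<open>G\<close> form a clopen part of \<open>G\<close>, hence all of \<open>G\<close>. Finitely many of these open sets cover
  \<open>K\<close>, and their union is connected because they all contain \<open>a\<close>.
\<close>

lemma connected_open_thickening:
  assumes lc: "locally_connected_space Y" and reg: "regular_space Y"
    and G: "openin Y G" "connectedin Y G" and K: "compactin Y K" "K \<subseteq> G"
  obtains V where "openin Y V" "connectedin Y V" "K \<subseteq> V" "Y closure_of V \<subseteq> G"
proof (cases "K = {}")
  case True
  then show ?thesis using that[of "{}"] by auto
next
  case False
  then obtain a where a: "a \<in> K" by blast
  define \<O> where "\<O> = {V. openin Y V \<and> connectedin Y V \<and> Y closure_of V \<subseteq> G}"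
  have small: "\<exists>V\<in>\<O>. x \<in> V" if x: "x \<in> G" for x
  proof -
    have nb: "neighbourhood_base_of (closedin Y) Y" using reg by (simp add: neighbourhood_base_of_closedin)
    obtain U F where UF: "openin Y U" "closedin Y F" "x \<in> U" "U \<subseteq> F" "F \<subseteq> G"
      using nb[unfolded neighbourhood_base_of, rule_format, OF conjI, OF G(1) x] by auto
    obtain V where V: "openin Y V" "connectedin Y V" "x \<in> V" "V \<subseteq> U"
      using lc[unfolded locally_connected_space, rule_format, OF conjI, OF UF(1,3)] by auto
    have "Y closure_of V \<subseteq> F" using closure_of_minimal[of V F Y] V UF by auto
    then show ?thesis using V UF unfolding \<O>_def by blast
  qed
  define R where "R = \<Union>{V\<in>\<O>. a \<in> V}"
  have "openin Y R" unfolding R_def \<O>_def by auto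
  have step: "x \<in> R" if x: "x \<in> V" "V \<in> \<O>" "V \<inter> R \<noteq> {}" for x V
  proof -
    obtain V' where V': "V' \<in> \<O>" "a \<in> V'" "V \<inter> V' \<noteq> {}" using x unfolding R_def by blast
    then have "V \<union> V' \<in> \<O>" using x V' unfolding \<O>_def
      by (auto intro: connectedin_Un)
    then show ?thesis unfolding R_def using x V' by blast
  qed
  have "G \<subseteq> R"
  proof (rule ccontr)
    assume *: "\<not> G \<subseteq> R"
    define Q where "Q = \<Union>{V\<in>\<O>. V \<inter> R = {}}"
    have "openin Y Q" unfolding Q_def \<O>_def by auto
    moreover have cover: "G \<subseteq> R \<union> Q"
    proof
      fix x assume "x \<in> G"
      then obtain V where V: "V \<in> \<O>" "x \<in> V" using small[of x] by blast
      show "x \<in> R \<union> Q"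
      proof (cases "V \<inter> R = {}")
        case True
        then show ?thesis using V unfolding Q_def by auto
      next
        case False
        then show ?thesis using step[OF V(2,1)] by auto
      qed
    qed
    moreover have "R \<inter> Q = {}" unfolding Q_def by auto
    moreover have "a \<in> R \<inter> G" using small[of a] a K(2) unfolding R_def by auto
    moreover have "Q \<inter> G \<noteq> {}" using * cover by auto
    ultimately show False
      using connectedinD[OF G(2) \<open>openin Y R\<close>, of Q] by auto
  qed
  then have "K \<subseteq> \<Union>{V\<in>\<O>. a \<in> V}" using K(2) unfolding R_def by auto
  then obtain \<F> where \<F>: "finite \<F>" "\<F> \<subseteq> {V\<in>\<O>. a \<in> V}" "K \<subseteq> \<Union>\<F>"
    using compactinD[OF K(1), of "{V\<in>\<O>. a \<in> V}"] unfolding \<O>_def by auto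
  show ?thesis
  proof (rule that)
    show "openin Y (\<Union>\<F>)" using \<F> unfolding \<O>_def by blast
    show "connectedin Y (\<Union>\<F>)"
      using \<F> unfolding \<O>_def by (intro connectedin_Union) blast+
    show "K \<subseteq> \<Union>\<F>" by fact
    show "Y closure_of \<Union>\<F> \<subseteq> G"
      using \<F> unfolding \<O>_def by (subst closure_of_Union) auto
  qed
qed

text \<open>
  The complement of \<open>V\<close> is a compact part of the connected open complement of \<open>H\<close>; thicken it to a
  connected open set \<open>G\<close>. The component of the complement of \<open>G\<close> around \<open>H\<close> is solid because \<open>G\<close> is
  connected, and it is a neighbourhood of \<open>H\<close> because even the closure of \<open>G\<close> misses \<open>H\<close>.
\<close>

lemma solid_enlargement:
  assumes Y: "compact_space Y" "Hausdorff_space Y" "connected_space Y" "locally_connected_space Y"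
    and H: "closedin Y H" "solid_in Y H" "H \<noteq> {}" and V: "openin Y V" "H \<subseteq> V"
  obtains H' U where "closedin Y H'" "solid_in Y H'" "openin Y U" "H \<subseteq> U" "U \<subseteq> H'" "H' \<subseteq> V"
proof -
  let ?S = "topspace Y"
  have "openin Y (?S - H)" "connectedin Y (?S - H)"
    using H unfolding solid_in_def by auto
  moreover have "compactin Y (?S - V)"
    using V Y closedin_compact_space by blast
  moreover have "regular_space Y" using Y compact_Hausdorff_imp_regular_space by blast
  ultimately obtain G where G: "openin Y G" "connectedin Y G" "?S - V \<subseteq> G" "Y closure_of G \<subseteq> ?S - H"
    using connected_open_thickening[of Y "?S - H" "?S - V"] Y V by blast
  have HS: "H \<subseteq> ?S" using H closedin_subset by blast
  have Gcl: "G \<subseteq> Y closure_of G" using G closure_of_subset openin_subset by metis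
  have Hcl: "H \<subseteq> ?S - Y closure_of G" using G HS by blast
  have Hconn: "connectedin Y H" using H unfolding solid_in_def by blast
  obtain U where U: "U \<in> comps Y (?S - Y closure_of G)" "H \<subseteq> U"
    using comps_superset[OF Hconn H(3) Hcl] by blast
  have Uop: "openin Y U"
    by (rule openin_comps[OF Y(4) _ U(1)]) auto
  obtain H' where H': "H' \<in> comps Y (?S - G)" "U \<subseteq> H'"
    using comps_superset[of Y U "?S - G"] compsD[OF U(1)] Gcl by blast
  have "closedin Y (?S - G)" using G by blast
  then have "closedin Y H'"
    using closedin_connected_components_of[OF H'(1)] closedin_trans_full by blast
  moreover have "solid_in Y H'"
    unfolding solid_in_def using compsD[OF H'(1)] connectedin_complement_comp[OF Y(3) G(2) H'(1)] by blast
  moreover have "H' \<subseteq> V" using compsD[OF H'(1)] G(3) by blast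
  ultimately show ?thesis using that Uop U(2) H'(2) by blast
qed

section \<open>Local connectedness of the one-point compactification\<close>

lemma connected_space_Alexandroff_compactification_noncompact:
  assumes "connected_space X" "\<not> compact_space X"
  shows "connected_space (Alexandroff_compactification X)"
proof -
  have "connectedin (Alexandroff_compactification X) (Some ` topspace X)"
    using assms(1) by (intro connectedin_continuous_map_image[OF continuous_map_Some])
      (simp add: connectedin_topspace)
  then show ?thesis
    using connectedin_closure_of Alexandroff_compactification_dense[OF assms(2)]
    by (metis connectedin_topspace)
qed

text \<open>
  Let \<open>U0\<close> be an open neighbourhood of \<open>K\<close> inside a compact set \<open>L\<close>. Finitely many components of
  \<open>X - K\<close> cover the compact shell \<open>L - U0\<close>. A component that misses the shell lies in \<open>U0\<close>, because
  otherwise it would be outside \<open>L\<close> and clopen in \<open>X\<close>. So only finitely many components matter outside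
  \<open>L\<close>: those with infinity in their closure become connected sets through infinity, and a
  neighbourhood of infinity avoids the others.
\<close>

lemma Alexandroff_connected_neighbourhood_infinity:
  assumes X: "connected_space X" "locally_connected_space X" "locally_compact_space X" "Hausdorff_space X"
    and nc: "\<not> compact_space X" and K: "compactin X K"
  defines "Y \<equiv> Alexandroff_compactification X"
  obtains U where "openin Y U" "None \<in> U" "U \<subseteq> topspace Y - Some ` K"
    "\<And>y. y \<in> U \<Longrightarrow> \<exists>C. connectedin Y C \<and> C \<subseteq> topspace Y - Some ` K \<and> None \<in> C \<and> y \<in> C"
proof (cases "K = {}")
  case True
  have "connectedin Y (topspace Y)"
    unfolding Y_def connectedin_topspace
    by (rule connected_space_Alexandroff_compactification_noncompact[OF X(1) nc])
  moreover have "None \<in> topspace Y" unfolding Y_def by simp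
  ultimately show ?thesis using that[of "topspace Y"] True by blast
next
  case False
  let ?S = "topspace X"
  obtain U0 L where L: "openin X U0" "compactin X L" "K \<subseteq> U0" "U0 \<subseteq> L"
    using locally_compact_space_compact_closed_compact[of X] X K by metis
  have Lcl: "closedin X L" and Kcl: "closedin X K"
    using L K X(4) compactin_imp_closedin by blast+
  have sub: "K \<subseteq> ?S" "L \<subseteq> ?S" using L K compactin_subset_topspace by blast+
  have op: "openin X (?S - K)" using Kcl by blast
  have "compactin X (L - U0)"
  proof -
    have "L - U0 = L \<inter> (?S - U0)" using sub by blast
    then show ?thesis using compact_Int_closedin[OF L(2), of "?S - U0"] L(1) by auto
  qed
  moreover have "L - U0 \<subseteq> \<Union>(comps X (?S - K))"
    using Union_comps[of "?S - K" X] L sub by blast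
  ultimately obtain \<W> where \<W>: "finite \<W>" "\<W> \<subseteq> comps X (?S - K)" "L - U0 \<subseteq> \<Union>\<W>"
    using compactinD[of X "L - U0" "comps X (?S - K)"] openin_comps[OF X(2) op] by metis
  have cover: "?S - L \<subseteq> \<Union>\<W>"
  proof
    fix z assume z: "z \<in> ?S - L"
    then obtain W where W: "W \<in> comps X (?S - K)" "z \<in> W"
      using Union_comps[of "?S - K" X] L(3,4) by blast
    have Wop: "openin X W" by (rule openin_comps[OF X(2) op W(1)])
    show "z \<in> \<Union>\<W>"
    proof (rule ccontr)
      assume "z \<notin> \<Union>\<W>"
      then have "W \<notin> \<W>" using W by blast
      have "W \<inter> W' = {}" if "W' \<in> \<W>" for W'
        using connected_components_of_overlap[OF W(1), of W'] that \<W>(2) \<open>W \<notin> \<W>\<close> by blast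
      then have "W \<inter> \<Union>\<W> = {}" by blast
      then have "W \<subseteq> U0 \<union> (?S - L)" using \<W>(3) compsD[OF W(1)] by blast
      then have "U0 \<inter> W = {}"
        using connectedinD[OF compsD(1)[OF W(1)] L(1), of "?S - L"] Lcl L(4) z W(2) by blast
      have "closedin (subtopology X (?S - K)) W"
        by (rule closedin_connected_components_of[OF W(1)])
      then obtain D where D: "closedin X D" "W = D \<inter> (?S - K)"
        unfolding closedin_subtopology by blast
      have "W = D \<inter> (?S - U0)" using D(2) L(3) \<open>U0 \<inter> W = {}\<close> by blast
      then have "closedin X W" using closedin_Int[OF D(1) closedin_diff[OF closedin_topspace L(1)]] by simp
      then have "W = {} \<or> W = ?S" using X(1) Wop unfolding connected_space_clopen_in by blast
      then show False using compsD[OF W(1)] False sub by blast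
    qed
  qed
  define \<W>0 where "\<W>0 = {W\<in>\<W>. None \<notin> Y closure_of (Some ` W)}"
  define U where "U = topspace Y - (Some ` L \<union> (\<Union>W\<in>\<W>0. Y closure_of (Some ` W)))"
  have SL: "closedin Y (Some ` L)" unfolding Y_def using L(2) Lcl by simp
  have fin0: "finite \<W>0" unfolding \<W>0_def using \<W>(1) by simp
  show ?thesis
  proof (rule that)
    have "closedin Y (\<Union>W\<in>\<W>0. Y closure_of (Some ` W))"
      using fin0 by (intro closedin_Union) auto
    then show "openin Y U" unfolding U_def using SL by blast
    show "None \<in> U" unfolding U_def \<W>0_def Y_def by auto
    show "U \<subseteq> topspace Y - Some ` K" unfolding U_def using L by blast
    fix y assume y: "y \<in> U"
    have S: "topspace Y = insert None (Some ` ?S)" unfolding Y_def by simp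
    show "\<exists>C. connectedin Y C \<and> C \<subseteq> topspace Y - Some ` K \<and> None \<in> C \<and> y \<in> C"
    proof (cases y)
      case None
      then show ?thesis by (intro exI[of _ "{None}"]) (auto simp: S)
    next
      case (Some z)
      then have z: "z \<in> ?S - L" using y unfolding U_def S by auto
      then obtain W where W: "W \<in> \<W>" "z \<in> W" using cover by blast
      have WS: "W \<subseteq> ?S - K" "connectedin X W" using W \<W> compsD[of W X "?S - K"] by blast+
      have SW: "Some ` W \<subseteq> topspace Y" using WS unfolding S by blast
      have "W \<notin> \<W>0"
      proof
        assume "W \<in> \<W>0"
        moreover have "Some z \<in> Y closure_of (Some ` W)"
          using closure_of_subset[OF SW] W by blast
        ultimately show False using y Some unfolding U_def by blast
      qed
      then have None: "None \<in> Y closure_of (Some ` W)" using W unfolding \<W>0_def by blast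
      have "connectedin Y (Some ` W)"
        unfolding Y_def by (rule connectedin_continuous_map_image[OF continuous_map_Some WS(2)])
      then have "connectedin Y (insert None (Some ` W))"
        by (rule connectedin_intermediate_closure_of) (use None closure_of_subset[OF SW] in auto)
      then show ?thesis
        using W Some WS by (intro exI[of _ "insert None (Some ` W)"]) (auto simp: S)
    qed
  qed
qed

lemma locally_connected_space_Alexandroff_compactification:
  assumes X: "connected_space X" "locally_connected_space X" "locally_compact_space X" "Hausdorff_space X"
    and nc: "\<not> compact_space X"
  shows "locally_connected_space (Alexandroff_compactification X)" (is "locally_connected_space ?Y")
  unfolding locally_connected_space_im_kleinen
proof (intro allI impI, elim conjE)
  fix V x assume V: "openin ?Y V" "x \<in> V"
  show "\<exists>U. openin ?Y U \<and> x \<in> U \<and> U \<subseteq> V \<and> (\<forall>y\<in>U. \<exists>C. connectedin ?Y C \<and> C \<subseteq> V \<and> x \<in> C \<and> y \<in> C)"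
  proof (cases x)
    case None
    then obtain K where K: "compactin X K" "V = insert None (Some ` (topspace X - K))"
      using V unfolding openin_Alexandroff_compactification by auto
    then have Veq: "V = topspace ?Y - Some ` K" by auto
    show ?thesis
      unfolding Veq None
      by (rule Alexandroff_connected_neighbourhood_infinity[OF X nc K(1)]) metis
  next
    case (Some a)
    define V0 where "V0 = {x \<in> topspace X. Some x \<in> V}"
    have "openin X V0" unfolding V0_def
      using continuous_map_Some[of X] V(1) unfolding continuous_map_def by blast
    moreover have "a \<in> V0" using V Some openin_subset[OF V(1)] unfolding V0_def by auto
    ultimately obtain U where U: "openin X U" "connectedin X U" "a \<in> U" "U \<subseteq> V0"
      using X(2)[unfolded locally_connected_space, rule_format, OF conjI] by metis
    have "openin ?Y (Some ` U)" using U by simp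
    moreover have "connectedin ?Y (Some ` U)"
      by (rule connectedin_continuous_map_image[OF continuous_map_Some U(2)])
    moreover have "Some ` U \<subseteq> V" using U unfolding V0_def by auto
    ultimately show ?thesis using U(3) Some by (intro exI[of _ "Some ` U"]) auto
  qed
qed

section \<open>Removing connected sets in a space of genus zero\<close>

locale genus_zero_space =
  fixes Y :: "'b topology"
  assumes compact: "compact_space Y" and Hausdorff: "Hausdorff_space Y"
    and connected: "connected_space Y" and locally_connected: "locally_connected_space Y"
    and genus: "genus_zero Y" and nonempty: "topspace Y \<noteq> {}"
begin

lemma connected_complement_solids:
  assumes "finite \<C>" "pairwise disjnt \<C>" "\<And>C. C \<in> \<C> \<Longrightarrow> closedin Y C \<and> solid_in Y C"
  shows "connectedin Y (topspace Y - \<Union>\<C>)"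
  using genus assms unfolding genus_zero_def by blast

lemma comps_topspace: "connected_components_of Y = {topspace Y}"
  using comps_eqI_closed[of "{topspace Y}" Y] connected nonempty
  by (simp add: connectedin_topspace)

text \<open>
  The components of the complement of a closed connected set are solid. For this reason values on
  solid sets suffice to determine a topological measure on connected sets.
\<close>

lemma complement_comp_solid:
  assumes N: "closedin Y N" "connectedin Y N" "N \<noteq> {}" and U: "U \<in> comps Y (topspace Y - N)"
  shows "openin Y U" "closedin Y (topspace Y - U)" "solid_in Y (topspace Y - U)" "N \<subseteq> topspace Y - U"
proof -
  show op: "openin Y U"
    using openin_comps[OF locally_connected _ U] N(1) by blast
  then show "closedin Y (topspace Y - U)" by blast
  have "topspace Y - (topspace Y - U) = U" using compsD[OF U] by blast
  then show "solid_in Y (topspace Y - U)"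
    unfolding solid_in_def
    using connectedin_complement_comp[OF connected N(2) U] compsD(1)[OF U] by simp
  show "N \<subseteq> topspace Y - U"
    using compsD[OF U] closedin_subset[OF N(1)] by blast
qed

definition finitely_holed :: "'b set \<Rightarrow> bool" where
  "finitely_holed W \<longleftrightarrow> W \<subseteq> topspace Y \<and> finite (comps Y (topspace Y - W)) \<and>
     (\<forall>H\<in>comps Y (topspace Y - W). closedin Y H \<and> solid_in Y H)"

definition closed_family :: "'b set set \<Rightarrow> bool" where
  "closed_family \<N> \<longleftrightarrow> finite \<N> \<and> pairwise disjnt \<N> \<and>
     (\<forall>N\<in>\<N>. N \<noteq> {} \<and> closedin Y N \<and> connectedin Y N)"

text \<open>
  The next lemmas describe how the removal of \<open>N\<close> cuts \<open>W\<close> into pieces. Every hole of \<open>W\<close> lies in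
  exactly one component \<open>U\<close> of the complement of \<open>N\<close>. What remains of \<open>U\<close> outside these holes is the
  complement of finitely many disjoint closed solid sets, namely the complement of \<open>U\<close> and the holes
  in \<open>U\<close>. This is where genus zero enters: the remainder is connected, so it is one piece of \<open>W - N\<close>.
\<close>

context
  fixes W N
  assumes W: "finitely_holed W" and N: "closedin Y N" "connectedin Y N" "N \<noteq> {}" "N \<subseteq> W"
begin

abbreviation "holes_in U \<equiv> {H \<in> comps Y (topspace Y - W). H \<subseteq> U}"
abbreviation "rest U \<equiv> U - \<Union>(holes_in U)"

lemma hole_in_unique_comp:
  assumes "H \<in> comps Y (topspace Y - W)"
  shows "\<exists>!U. U \<in> comps Y (topspace Y - N) \<and> H \<subseteq> U"
proof -
  have "H \<subseteq> topspace Y - N" using compsD[OF assms] N(4) by blast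
  then obtain U where U: "U \<in> comps Y (topspace Y - N)" "H \<subseteq> U"
    using comps_superset[OF compsD(1,2)[OF assms]] by metis
  moreover have "U' = U" if "U' \<in> comps Y (topspace Y - N)" "H \<subseteq> U'" for U'
    using connected_components_of_overlap[OF that(1) U(1)] that U compsD(2)[OF assms] by blast
  ultimately show ?thesis by blast
qed

lemma rest_properties:
  assumes U: "U \<in> comps Y (topspace Y - N)"
  shows "connectedin Y (rest U)" "openin Y (rest U)" "rest U \<noteq> {}"
    "comps Y (topspace Y - rest U) = insert (topspace Y - U) (holes_in U)"
    "finitely_holed (rest U)"
proof -
  let ?C = "insert (topspace Y - U) (holes_in U)"
  note sU = complement_comp_solid[OF N(1-3) U]
  have fin: "finite ?C" using W unfolding finitely_holed_def by simp
  have disj: "pairwise disjnt ?C"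
  proof (rule pairwise_insert[THEN iffD2], intro conjI allI impI)
    show "pairwise disjnt (holes_in U)"
      by (rule pairwise_subset[OF comps_disjnt]) auto
  qed (auto simp: disjnt_def)
  have sol: "closedin Y C \<and> solid_in Y C" if "C \<in> ?C" for C
    using that sU W unfolding finitely_holed_def by blast
  have ne: "C \<noteq> {}" if "C \<in> ?C" for C
    using that sU(4) N(3) compsD(2) by blast
  have compl: "topspace Y - rest U = \<Union>?C"
    using compsD[OF U] compsD(4) by blast
  have RU: "rest U = topspace Y - \<Union>?C" using compsD[OF U] by blast
  show "connectedin Y (rest U)"
    unfolding RU by (rule connected_complement_solids[OF fin disj sol])
  have "closedin Y (\<Union>?C)" using fin sol by (intro closedin_Union) auto
  then show "openin Y (rest U)" unfolding RU by blast
  show cC: "comps Y (topspace Y - rest U) = ?C"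
    using fin disj sol ne compl
    by (intro comps_eqI_closed) (auto simp: solid_in_def)
  show "finitely_holed (rest U)"
    unfolding finitely_holed_def cC using fin sol compsD[OF U] by blast
  \<comment> \<open>finitely many disjoint nonempty closed connected sets that cover the space are its components, so there is only one\<close>
  show "rest U \<noteq> {}"
  proof
    assume empty: "rest U = {}"
    have "?C = {topspace Y}" using cC comps_topspace unfolding empty by simp
    then have "topspace Y - U = topspace Y" by blast
    then show False using compsD[OF U] by blast
  qed
qed

lemma inj_on_rest: "inj_on (\<lambda>U. rest U) (comps Y (topspace Y - N))"
proof (rule inj_onI)
  fix U U' assume U: "U \<in> comps Y (topspace Y - N)" "U' \<in> comps Y (topspace Y - N)" "rest U = rest U'"
  then have "U \<inter> U' \<noteq> {}" using rest_properties(3)[OF U(1)] by blast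
  then show "U = U'" using connected_components_of_overlap[OF U(1,2)] by blast
qed

lemma comps_Diff_closed_connected: "comps Y (W - N) = (\<lambda>U. rest U) ` comps Y (topspace Y - N)"
proof (rule comps_eqI_open)
  show "pairwise disjnt ((\<lambda>U. rest U) ` comps Y (topspace Y - N))"
    using comps_disjnt[of Y "topspace Y - N"] unfolding pairwise_def disjnt_def by fast
  show "connectedin Y V \<and> V \<noteq> {} \<and> openin Y V"
    if V: "V \<in> (\<lambda>U. rest U) ` comps Y (topspace Y - N)" for V
  proof -
    obtain U where "U \<in> comps Y (topspace Y - N)" "V = rest U" using V by blast
    then show ?thesis using rest_properties(1-3)[of U] by blast
  qed
  have WS: "W \<subseteq> topspace Y" using W unfolding finitely_holed_def by blast
  have UH: "\<Union>(comps Y (topspace Y - W)) = topspace Y - W" by (rule Union_comps) blast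
  have UU: "\<Union>(comps Y (topspace Y - N)) = topspace Y - N" by (rule Union_comps) blast
  show "W - N = (\<Union>U\<in>comps Y (topspace Y - N). rest U)"
  proof (intro equalityI subsetI)
    fix x assume x: "x \<in> W - N"
    then obtain U where U: "U \<in> comps Y (topspace Y - N)" "x \<in> U" using UU WS by blast
    moreover have "x \<notin> \<Union>(holes_in U)" using x UH by blast
    ultimately show "x \<in> (\<Union>U\<in>comps Y (topspace Y - N). rest U)" by blast
  next
    fix x assume "x \<in> (\<Union>U\<in>comps Y (topspace Y - N). rest U)"
    then obtain U where U: "U \<in> comps Y (topspace Y - N)" "x \<in> rest U" by blast
    have "x \<in> topspace Y - N" using U UU by blast
    moreover have "x \<in> W"
    proof (rule ccontr)
      assume "x \<notin> W"
      then obtain H where H: "H \<in> comps Y (topspace Y - W)" "x \<in> H" using UH \<open>x \<in> topspace Y - N\<close> by blast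
      obtain U' where U': "U' \<in> comps Y (topspace Y - N)" "H \<subseteq> U'" using hole_in_unique_comp[OF H(1)] by blast
      then have "U' = U" using connected_components_of_overlap[OF U'(1) U(1)] H U by blast
      then show False using U U' H by blast
    qed
    ultimately show "x \<in> W - N" by blast
  qed
qed

end

end

section \<open>The mass of a connected set\<close>

lemma has_sum_sum_finite:
  fixes f :: "'i \<Rightarrow> 'b \<Rightarrow> real"
  assumes "finite I" "\<And>i. i \<in> I \<Longrightarrow> (f i has_sum s i) A"
  shows "((\<lambda>x. \<Sum>i\<in>I. f i x) has_sum (\<Sum>i\<in>I. s i)) A"
  using assms by (induction I) (auto intro: has_sum_add)

text \<open>
  A weight stands for the restriction of a topological measure to solid sets. On arbitrary open and
  closed sets only superadditivity and outer regularity are required of this nonnegative function; full additivity is asked for a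
  set and its complement only. That case is what the partition of the space into a solid set and its
  complement needs.
\<close>

locale complementary_weight = genus_zero_space Y for Y :: "'b topology" +
  fixes lam :: "'b set \<Rightarrow> real"
  assumes lam_nonneg: "\<And>A. open_or_closed_in Y A \<Longrightarrow> 0 \<le> lam A"
    and lam_complement: "\<And>A. open_or_closed_in Y A \<Longrightarrow> lam A + lam (topspace Y - A) = lam (topspace Y)"
    and lam_superadditive: "\<And>\<A> B. finite \<A> \<Longrightarrow> pairwise disjnt \<A> \<Longrightarrow> (\<And>A. A \<in> \<A> \<Longrightarrow> open_or_closed_in Y A)
           \<Longrightarrow> open_or_closed_in Y B \<Longrightarrow> \<Union>\<A> \<subseteq> B \<Longrightarrow> sum lam \<A> \<le> lam B"
    and lam_outer_regular: "\<And>H V e. closedin Y H \<Longrightarrow> openin Y V \<Longrightarrow> H \<subseteq> V \<Longrightarrow> (0::real) < e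
           \<Longrightarrow> \<exists>V'. openin Y V' \<and> H \<subseteq> V' \<and> V' \<subseteq> V \<and> lam V' < lam H + e"
begin

lemma open_or_closed_in_subset: "open_or_closed_in Y A \<Longrightarrow> A \<subseteq> topspace Y"
  unfolding open_or_closed_in_def by (metis openin_subset closedin_subset)

lemma lam_mono:
  "open_or_closed_in Y A \<Longrightarrow> open_or_closed_in Y B \<Longrightarrow> A \<subseteq> B \<Longrightarrow> lam A \<le> lam B"
  using lam_superadditive[of "{A}" B] by simp

lemma lam_summable_disjoint:
  assumes "pairwise disjnt \<U>" "\<And>U. U \<in> \<U> \<Longrightarrow> open_or_closed_in Y U"
  shows "lam summable_on \<U>"
proof (rule nonneg_bdd_above_summable_on)
  show "0 \<le> lam U" if "U \<in> \<U>" for U using that assms lam_nonneg by blast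
  have "sum lam F \<le> lam (topspace Y)" if "F \<subseteq> \<U>" "finite F" for F
  proof (rule lam_superadditive)
    show "\<Union>F \<subseteq> topspace Y"
      using that(1) assms(2) open_or_closed_in_subset by blast
    show "pairwise disjnt F" by (rule pairwise_subset[OF assms(1) that(1)])
  qed (use that assms(2) in \<open>auto simp: open_or_closed_in_def\<close>)
  then show "bdd_above (sum lam ` {F. F \<subseteq> \<U> \<and> finite F})" by (auto simp: bdd_above_def)
qed

text \<open>
  For a connected set \<open>A\<close> this is the only value that a countably additive extension of the weight from
  solid sets can have, because the space is the disjoint union of \<open>A\<close> and the components of its
  complement. It is used for closed connected sets and for open sets with finitely many holes.
\<close>

definition mass :: "'b set \<Rightarrow> real" where
  "mass A = lam (topspace Y) - (\<Sum>\<^sub>\<infinity>B\<in>comps Y (topspace Y - A). lam B)"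

lemma lam_has_sum_mass:
  assumes "closedin Y N" "connectedin Y N" "N \<noteq> {}"
  shows "(lam has_sum (lam (topspace Y) - mass N)) (comps Y (topspace Y - N))"
proof -
  have "lam summable_on (comps Y (topspace Y - N))"
    using complement_comp_solid(1)[OF assms]
    by (intro lam_summable_disjoint comps_disjnt) (auto simp: open_or_closed_in_def)
  then show ?thesis unfolding mass_def by simp
qed

lemma mass_finitely_holed:
  "finitely_holed W \<Longrightarrow> mass W = lam (topspace Y) - sum lam (comps Y (topspace Y - W))"
  unfolding mass_def finitely_holed_def by simp

lemma mass_finitely_holed_nonneg:
  assumes "finitely_holed W"
  shows "0 \<le> mass W"
proof -
  have "sum lam (comps Y (topspace Y - W)) \<le> lam (topspace Y)"
  proof (rule lam_superadditive)
    show "open_or_closed_in Y H" if "H \<in> comps Y (topspace Y - W)" for H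
      using assms that unfolding finitely_holed_def open_or_closed_in_def by simp
    show "\<Union>(comps Y (topspace Y - W)) \<subseteq> topspace Y" by (simp add: Union_comps)
  qed (use assms comps_disjnt in \<open>simp_all add: finitely_holed_def open_or_closed_in_def\<close>)
  then show ?thesis using mass_finitely_holed[OF assms] by simp
qed

lemma mass_topspace: "mass (topspace Y) = lam (topspace Y)"
  unfolding mass_def by (simp add: connected_components_of_empty_space)

text \<open>
  The piece of \<open>W - N\<close> inside the component \<open>U\<close> of the complement of \<open>N\<close> has the weight of \<open>U\<close> minus the
  weights of the holes of \<open>W\<close> in \<open>U\<close>. Summing over \<open>U\<close> counts each hole once, which leaves
  \<open>lam Y - mass N\<close> minus the weights of all holes.
\<close>

lemma mass_has_sum_Diff:
  assumes W: "finitely_holed W" and N: "closedin Y N" "connectedin Y N" "N \<noteq> {}" "N \<subseteq> W"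
  shows "(mass has_sum (mass W - mass N)) (comps Y (W - N))"
    and "\<And>V. V \<in> comps Y (W - N) \<Longrightarrow> finitely_holed V"
proof -
  let ?S = "topspace Y"
  let ?\<H> = "comps Y (?S - W)" and ?\<U> = "comps Y (?S - N)"
  let ?in = "\<lambda>U. {H \<in> ?\<H>. H \<subseteq> U}"
  let ?R = "\<lambda>U. U - \<Union>(?in U)"
  note rest = rest_properties[OF W N]
  have finH: "finite ?\<H>" using W unfolding finitely_holed_def by blast
  have massR: "mass (?R U) = lam U - (\<Sum>H\<in>?\<H>. if H \<subseteq> U then lam H else 0)" if U: "U \<in> ?\<U>" for U
  proof -
    note sU = complement_comp_solid[OF N(1-3) U]
    have "?S - U \<noteq> {}" using sU(4) N(3) by blast
    then have "?S - U \<notin> ?in U" by blast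
    then have "mass (?R U) = lam ?S - (lam (?S - U) + sum lam (?in U))"
      using mass_finitely_holed[OF rest(5)[OF U]] rest(4)[OF U] finH by simp
    moreover have "lam ?S - lam (?S - U) = lam U"
      using lam_complement[of U] sU(1) unfolding open_or_closed_in_def by simp
    ultimately show ?thesis using finH by (simp add: sum.inter_filter)
  qed
  have one: "((\<lambda>U. if H \<subseteq> U then lam H else 0) has_sum lam H) ?\<U>" if H: "H \<in> ?\<H>" for H
  proof -
    obtain U where U: "U \<in> ?\<U>" "H \<subseteq> U" and uniq: "\<And>U'. U' \<in> ?\<U> \<Longrightarrow> H \<subseteq> U' \<Longrightarrow> U' = U"
      using hole_in_unique_comp[OF W N H] by blast
    show ?thesis
    proof (rule has_sum_finite_neutralI[of "{U}"])
      show "(if H \<subseteq> U' then lam H else 0) = 0" if "U' \<in> ?\<U> - {U}" for U'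
        using uniq[of U'] that by auto
    qed (use U in simp_all)
  qed
  have "((\<lambda>U. \<Sum>H\<in>?\<H>. if H \<subseteq> U then lam H else 0) has_sum (\<Sum>H\<in>?\<H>. lam H)) ?\<U>"
    using finH one by (rule has_sum_sum_finite)
  from has_sum_add[OF lam_has_sum_mass[OF N(1-3)] has_sum_uminusI[OF this]]
  have "((\<lambda>U. lam U - (\<Sum>H\<in>?\<H>. if H \<subseteq> U then lam H else 0)) has_sum
      (lam ?S - mass N - sum lam ?\<H>)) ?\<U>" by simp
  then have "((mass \<circ> ?R) has_sum (lam ?S - mass N - sum lam ?\<H>)) ?\<U>"
    using massR by (subst has_sum_cong) (simp_all add: o_def)
  then have "(mass has_sum (lam ?S - mass N - sum lam ?\<H>)) (?R ` ?\<U>)"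
    by (rule has_sum_reindex[OF inj_on_rest[OF W N], THEN iffD2])
  then show "(mass has_sum (mass W - mass N)) (comps Y (W - N))"
    unfolding comps_Diff_closed_connected[OF W N] mass_finitely_holed[OF W] by (simp add: algebra_simps)
  show "finitely_holed V" if "V \<in> comps Y (W - N)" for V
  proof -
    have "V \<in> ?R ` ?\<U>" using that unfolding comps_Diff_closed_connected[OF W N] .
    then obtain U where U: "U \<in> ?\<U>" "V = ?R U" by (rule imageE)
    show ?thesis unfolding U(2) by (rule rest(5)[OF U(1)])
  qed
qed

text \<open>
  This identity is the additivity of the measure in disguise. In the induction a new member of the
  family lies in a single component of the complement of the others, and it only redistributes the
  mass of that component.
\<close>

lemma mass_has_sum_complement:
  assumes "closed_family \<N>"
  shows "(mass has_sum (lam (topspace Y) - sum mass \<N>)) (comps Y (topspace Y - \<Union>\<N>)) \<and>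
    (\<forall>W\<in>comps Y (topspace Y - \<Union>\<N>). finitely_holed W)"
proof -
  have "finite \<N>" using assms unfolding closed_family_def by blast
  then show ?thesis using assms
  proof (induction \<N>)
    case empty
    have "finitely_holed (topspace Y)"
      unfolding finitely_holed_def by (simp add: connected_components_of_empty_space)
    moreover have "(mass has_sum lam (topspace Y)) {topspace Y}"
      by (rule has_sum_finiteI) (simp_all add: mass_topspace)
    ultimately show ?case by (simp add: comps_topspace)
  next
    case (insert N \<N>)
    let ?S = "topspace Y"
    have fam: "closed_family \<N>" and N: "closedin Y N" "connectedin Y N" "N \<noteq> {}"
      using insert.prems insert.hyps unfolding closed_family_def pairwise_insert by simp_all
    have "pairwise disjnt (insert N \<N>)" using insert.prems unfolding closed_family_def by simp
    then have "\<And>N'. N' \<in> \<N> \<Longrightarrow> disjnt N N'"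
      using insert.hyps(2) by (auto simp: pairwise_insert)
    then have disj: "N \<inter> \<Union>\<N> = {}" unfolding disjnt_def by auto
    let ?\<W> = "comps Y (?S - \<Union>\<N>)"
    have IH: "(mass has_sum (lam ?S - sum mass \<N>)) ?\<W>" "\<And>W. W \<in> ?\<W> \<Longrightarrow> finitely_holed W"
      using insert.IH[OF fam] by auto
    have "N \<subseteq> ?S - \<Union>\<N>" using disj closedin_subset[OF N(1)] by blast
    then obtain W where W: "W \<in> ?\<W>" "N \<subseteq> W"
      using comps_superset[OF N(2,3)] by metis
    note D = mass_has_sum_Diff[OF IH(2)[OF W(1)] N W(2)]
    have opS: "openin Y (?S - \<Union>\<N>)"
      using fam unfolding closed_family_def by (intro openin_diff closedin_Union) auto
    have opW: "openin Y V" if "V \<in> ?\<W>" for V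
      by (rule openin_comps[OF locally_connected opS that])
    have opWN: "openin Y V" if "V \<in> comps Y (W - N)" for V
      by (rule openin_comps[OF locally_connected _ that]) (use opW[OF W(1)] N(1) in blast)
    have sep: "V \<inter> V' = {}" if "V \<in> ?\<W> - {W}" "V' \<in> comps Y (W - N)" for V V'
      using connected_components_of_overlap[of V _ W] that W(1) compsD(3)[OF that(2)] by blast
    have eq: "comps Y (?S - \<Union>(insert N \<N>)) = (?\<W> - {W}) \<union> comps Y (W - N)"
    proof (rule comps_eqI_open)
      show "pairwise disjnt (?\<W> - {W} \<union> comps Y (W - N))"
        using comps_disjnt[of Y "?S - \<Union>\<N>"] comps_disjnt[of Y "W - N"] sep
        unfolding pairwise_def disjnt_def by (metis Diff_iff Int_commute Un_iff)
      show "connectedin Y U \<and> U \<noteq> {} \<and> openin Y U" if "U \<in> ?\<W> - {W} \<union> comps Y (W - N)" for U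
        using that opW opWN compsD(1,2) by (metis Diff_iff Un_iff)
      have u1: "\<Union>?\<W> = ?S - \<Union>\<N>" by (rule Union_comps) blast
      have u2: "\<Union>(comps Y (W - N)) = W - N" by (rule Union_comps) (use compsD[OF W(1)] in blast)
      have ol: "V \<inter> W = {}" if "V \<in> ?\<W> - {W}" for V
        using connected_components_of_overlap[of V _ W] that W(1) by auto
      have "\<Union>(?\<W> - {W}) = \<Union>?\<W> - W"
      proof (intro equalityI subsetI)
        fix x assume "x \<in> \<Union>(?\<W> - {W})"
        then obtain V where "V \<in> ?\<W> - {W}" "x \<in> V" by blast
        then show "x \<in> \<Union>?\<W> - W" using ol[of V] by auto
      qed auto
      then have "\<Union>(?\<W> - {W} \<union> comps Y (W - N)) = (?S - \<Union>\<N> - W) \<union> (W - N)"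
        using u1 u2 by simp
      also have "\<dots> = ?S - \<Union>(insert N \<N>)"
        using W(2) compsD(3)[OF W(1)] by auto
      finally show "?S - \<Union>(insert N \<N>) = \<Union>(?\<W> - {W} \<union> comps Y (W - N))" by (rule sym)
    qed
    have "(mass has_sum (lam ?S - sum mass \<N> - mass W)) (?\<W> - {W})"
      using has_sum_Diff[OF IH(1) has_sum_finiteI[of "{W}" "mass W" mass]] W(1) by simp
    moreover have "(?\<W> - {W}) \<inter> comps Y (W - N) = {}"
    proof (rule equals0I)
      fix V assume "V \<in> (?\<W> - {W}) \<inter> comps Y (W - N)"
      then show False using sep[of V V] compsD(2)[of V Y "W - N"] by simp
    qed
    ultimately have "(mass has_sum (lam ?S - sum mass \<N> - mass W + (mass W - mass N)))
        ((?\<W> - {W}) \<union> comps Y (W - N))"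
      using D(1) by (intro has_sum_Un_disjoint) auto
    then show ?case
      using eq D(2) IH(2) insert.hyps by (auto simp: algebra_simps)
  qed
qed

end

section \<open>Inner and outer measure\<close>

lemma Hausdorff_disjoint_neighbourhoods:
  assumes X: "Hausdorff_space X" and fin: "finite \<K>"
    and "pairwise disjnt \<K>" "\<And>K. K \<in> \<K> \<Longrightarrow> compactin X K"
  shows "\<exists>V. (\<forall>K\<in>\<K>. openin X (V K) \<and> K \<subseteq> V K) \<and> (\<forall>K\<in>\<K>. \<forall>L\<in>\<K>. K \<noteq> L \<longrightarrow> disjnt (V K) (V L))"
  using fin assms(3,4)
proof (induction \<K>)
  case (insert K \<K>)
  have disj: "pairwise disjnt \<K>" "\<And>L. L \<in> \<K> \<Longrightarrow> disjnt K L"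
    using insert.prems(1) insert.hyps(2) by (auto simp: pairwise_insert)
  obtain V where V: "\<forall>K\<in>\<K>. openin X (V K) \<and> K \<subseteq> V K"
    "\<forall>K\<in>\<K>. \<forall>L\<in>\<K>. K \<noteq> L \<longrightarrow> disjnt (V K) (V L)"
    using insert.IH[OF disj(1)] insert.prems(2) by auto
  have "compactin X (\<Union>\<K>)" using insert.prems(2) insert.hyps(1) by (intro compactin_Union) auto
  moreover have "disjnt K (\<Union>\<K>)" using disj(2) by (auto simp: disjnt_def)
  moreover have "compactin X K" using insert.prems(2) by simp
  ultimately obtain A B where AB: "openin X A" "openin X B" "K \<subseteq> A" "\<Union>\<K> \<subseteq> B" "disjnt A B"
    using Hausdorff_space_compact_separation[OF X] by metis
  define V' where "V' = (\<lambda>L. if L = K then A else V L \<inter> B)"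
  have "\<forall>L\<in>insert K \<K>. openin X (V' L) \<and> L \<subseteq> V' L"
    using V(1) AB unfolding V'_def by auto
  moreover have "\<forall>L\<in>insert K \<K>. \<forall>M\<in>insert K \<K>. L \<noteq> M \<longrightarrow> disjnt (V' L) (V' M)"
  proof (intro ballI impI)
    fix L M assume LM: "L \<in> insert K \<K>" "M \<in> insert K \<K>" "L \<noteq> M"
    show "disjnt (V' L) (V' M)"
    proof (cases "L = K \<or> M = K")
      case True
      then show ?thesis using AB(5) LM(3) unfolding V'_def disjnt_def by auto
    next
      case False
      then have "disjnt (V L) (V M)" using V(2) LM by auto
      then show ?thesis using False unfolding V'_def disjnt_def by auto
    qed
  qed
  ultimately show ?case by blast
qed simp

context genus_zero_space
begin

lemma connected_neighbourhood_closure_subset: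
  assumes "openin Y V" "x \<in> V"
  obtains U where "openin Y U" "connectedin Y U" "x \<in> U" "Y closure_of U \<subseteq> V"
proof -
  obtain G where G: "openin Y G" "connectedin Y G" "x \<in> G" "G \<subseteq> V"
    using locally_connected[unfolded locally_connected_space, rule_format, OF conjI, OF assms] by auto
  have "x \<in> topspace Y" using assms openin_subset by blast
  then obtain U where "openin Y U" "connectedin Y U" "{x} \<subseteq> U" "Y closure_of U \<subseteq> G"
    using connected_open_thickening[OF locally_connected compact_Hausdorff_imp_regular_space[OF compact Hausdorff] G(1,2), of "{x}"] G(3)
    by auto
  then show ?thesis using that G(4) by auto
qed

text \<open>
  Finitely many connected open sets with closures inside \<open>V\<close> cover \<open>K\<close>. The union of their closures
  has finitely many components, since every component contains one of the closures.
\<close>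

lemma finite_closed_connected_cover:
  assumes K: "closedin Y K" and V: "openin Y V" "K \<subseteq> V"
  obtains \<N> where "closed_family \<N>" "K \<subseteq> \<Union>\<N>" "\<Union>\<N> \<subseteq> V"
proof -
  define \<O> where "\<O> = {U. openin Y U \<and> connectedin Y U \<and> U \<noteq> {} \<and> Y closure_of U \<subseteq> V}"
  have "K \<subseteq> \<Union>\<O>"
  proof
    fix x assume "x \<in> K"
    then have "x \<in> V" using V by blast
    then obtain U where "openin Y U" "connectedin Y U" "x \<in> U" "Y closure_of U \<subseteq> V"
      by (rule connected_neighbourhood_closure_subset[OF V(1)])
    then show "x \<in> \<Union>\<O>" unfolding \<O>_def by auto
  qed
  moreover have "compactin Y K" using K compact closedin_compact_space by blast
  ultimately obtain \<F> where \<F>: "finite \<F>" "\<F> \<subseteq> \<O>" "K \<subseteq> \<Union>\<F>"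
    using compactinD[of Y K \<O>] unfolding \<O>_def by auto
  have F: "openin Y U" "connectedin Y (Y closure_of U)" "U \<subseteq> Y closure_of U" "U \<noteq> {}" "Y closure_of U \<subseteq> V"
    if "U \<in> \<F>" for U
  proof -
    have "U \<in> \<O>" using that \<F>(2) by blast
    then show "openin Y U" "U \<noteq> {}" "Y closure_of U \<subseteq> V" "connectedin Y (Y closure_of U)"
      unfolding \<O>_def by (auto intro: connectedin_closure_of)
    then show "U \<subseteq> Y closure_of U" by (simp add: closure_of_subset openin_subset)
  qed
  define A where "A = (\<Union>U\<in>\<F>. Y closure_of U)"
  have Acl: "closedin Y A" unfolding A_def using \<F>(1) by (intro closedin_Union) auto
  have KA: "K \<subseteq> A"
  proof
    fix x assume "x \<in> K"
    then obtain U where "U \<in> \<F>" "x \<in> U" using \<F>(3) by blast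
    then show "x \<in> A" using F(3)[of U] unfolding A_def by auto
  qed
  have un: "\<Union>(comps Y A) = A" by (rule Union_comps) (rule closedin_subset[OF Acl])
  have meet: "\<exists>U\<in>\<F>. Y closure_of U \<subseteq> W" if W: "W \<in> comps Y A" for W
  proof -
    obtain x where x: "x \<in> W" using compsD(2)[OF W] by blast
    then have "x \<in> A" using compsD(3)[OF W] by blast
    then obtain U where U: "U \<in> \<F>" "x \<in> Y closure_of U" unfolding A_def by blast
    have "Y closure_of U \<subseteq> W"
      by (rule comps_maximal[OF W F(2)[OF U(1)]]) (use U x in \<open>auto simp: A_def\<close>)
    then show ?thesis using U by blast
  qed
  then obtain f where f: "\<And>W. W \<in> comps Y A \<Longrightarrow> f W \<in> \<F> \<and> Y closure_of (f W) \<subseteq> W" by metis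
  have "inj_on f (comps Y A)"
  proof (rule inj_onI)
    fix W W' assume W: "W \<in> comps Y A" "W' \<in> comps Y A" "f W = f W'"
    have fW: "f W \<in> \<F>" using f[OF W(1)] by simp
    have "f W \<subseteq> W" "f W \<subseteq> W'" using f[OF W(1)] f[OF W(2)] W(3) F(3)[OF fW] by auto
    then have "W \<inter> W' \<noteq> {}" using F(4)[OF fW] by auto
    then show "W = W'" using connected_components_of_overlap[OF W(1,2)] by simp
  qed
  then have "finite (comps Y A)"
    by (rule inj_on_finite[of f _ \<F>]) (use f \<F>(1) in auto)
  moreover have "closedin Y W" if "W \<in> comps Y A" for W
    using closedin_connected_components_of[OF that] closedin_trans_full[OF _ Acl] by simp
  ultimately have "closed_family (comps Y A)"
    unfolding closed_family_def using comps_disjnt[of Y A] compsD(1,2)[of _ Y A] by simp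
  moreover have "A \<subseteq> V" unfolding A_def using F(5) by auto
  ultimately show ?thesis using that[of "comps Y A"] KA un by simp
qed

lemma closed_family_Un:
  assumes "closed_family \<M>" "closed_family \<N>" "\<Union>\<M> \<inter> \<Union>\<N> = {}"
  shows "closed_family (\<M> \<union> \<N>)" "\<M> \<inter> \<N> = {}"
proof -
  have MN: "disjnt M N" if "M \<in> \<M>" "N \<in> \<N>" for M N
    using assms(3) that unfolding disjnt_def by blast
  show "\<M> \<inter> \<N> = {}"
  proof (rule equals0I)
    fix N assume "N \<in> \<M> \<inter> \<N>"
    then show False using MN[of N N] assms(1) unfolding closed_family_def by auto
  qed
  show "closed_family (\<M> \<union> \<N>)"
    using assms(1,2) MN unfolding closed_family_def pairwise_def by (metis Un_iff disjnt_sym finite_Un)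
qed

lemma closed_family_subset: "closed_family \<N> \<Longrightarrow> \<M> \<subseteq> \<N> \<Longrightarrow> closed_family \<M>"
  unfolding closed_family_def using pairwise_subset[of disjnt \<N> \<M>] finite_subset[of \<M> \<N>]
  by (simp add: subset_iff)

lemma closed_family_closedin: "closed_family \<N> \<Longrightarrow> closedin Y (\<Union>\<N>)"
  unfolding closed_family_def by (simp add: closedin_Union)

end

context complementary_weight
begin

definition inner :: "'b set \<Rightarrow> real" where
  "inner U = (SUP \<N>\<in>{\<N>. closed_family \<N> \<and> \<Union>\<N> \<subseteq> U}. sum mass \<N>)"

lemma mass_family_le:
  assumes "closed_family \<N>"
  shows "sum mass \<N> \<le> lam (topspace Y)"
proof -
  note * = mass_has_sum_complement[OF assms]
  have "0 \<le> lam (topspace Y) - sum mass \<N>"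
    by (rule has_sum_nonneg[of mass]) (use * mass_finitely_holed_nonneg in auto)
  then show ?thesis by simp
qed

lemma inner_upper:
  assumes "closed_family \<N>" "\<Union>\<N> \<subseteq> U"
  shows "sum mass \<N> \<le> inner U"
  unfolding inner_def
proof (rule cSUP_upper)
  show "bdd_above (sum mass ` {\<N>. closed_family \<N> \<and> \<Union>\<N> \<subseteq> U})"
    by (rule bdd_aboveI2[of _ _ "lam (topspace Y)"]) (simp add: mass_family_le)
qed (use assms in simp)

lemma closed_family_empty: "closed_family {}"
  unfolding closed_family_def by simp

lemma inner_least:
  assumes "\<And>\<N>. closed_family \<N> \<Longrightarrow> \<Union>\<N> \<subseteq> U \<Longrightarrow> sum mass \<N> \<le> c"
  shows "inner U \<le> c"
proof -
  have "{} \<in> {\<N>. closed_family \<N> \<and> \<Union>\<N> \<subseteq> U}" using closed_family_empty by simp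
  then show ?thesis unfolding inner_def by (intro cSUP_least) (use assms in auto)
qed

lemma inner_approx:
  assumes "0 < e"
  obtains \<N> where "closed_family \<N>" "\<Union>\<N> \<subseteq> U" "inner U < sum mass \<N> + e"
proof -
  have "\<exists>\<N>. closed_family \<N> \<and> \<Union>\<N> \<subseteq> U \<and> inner U < sum mass \<N> + e"
  proof (rule ccontr)
    assume *: "\<not> ?thesis"
    have "inner U \<le> inner U - e"
    proof (rule inner_least)
      fix \<N> assume "closed_family \<N>" "\<Union>\<N> \<subseteq> U"
      then have "\<not> inner U < sum mass \<N> + e" using * by simp
      then show "sum mass \<N> \<le> inner U - e" by simp
    qed
    then show False using assms by simp
  qed
  then show ?thesis using that by auto
qed

lemma inner_nonneg: "0 \<le> inner U"
  using inner_upper[OF closed_family_empty, of U] by simp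

lemma inner_mono: "U \<subseteq> V \<Longrightarrow> inner U \<le> inner V"
  by (intro inner_least inner_upper) auto

lemma inner_empty: "inner {} = 0"
proof (rule antisym[OF _ inner_nonneg])
  show "inner {} \<le> 0"
  proof (rule inner_least)
    fix \<N> :: "'b set set" assume "closed_family \<N>" "\<Union>\<N> \<subseteq> {}"
    then have "\<N> = {}" unfolding closed_family_def by auto
    then show "sum mass \<N> \<le> 0" by simp
  qed
qed

lemma inner_topspace: "inner (topspace Y) = lam (topspace Y)"
proof (rule antisym)
  show "inner (topspace Y) \<le> lam (topspace Y)" by (rule inner_least) (rule mass_family_le)
  have "closed_family {topspace Y}"
    unfolding closed_family_def using connected nonempty by (simp add: connectedin_topspace)
  then show "lam (topspace Y) \<le> inner (topspace Y)"
    using inner_upper[of "{topspace Y}" "topspace Y"] by (simp add: mass_topspace)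
qed

lemma inner_superadditive:
  assumes "U \<inter> V = {}"
  shows "inner U + inner V \<le> inner (U \<union> V)"
proof (rule field_le_epsilon)
  fix e :: real assume "0 < e"
  obtain \<M> where M: "closed_family \<M>" "\<Union>\<M> \<subseteq> U" "inner U < sum mass \<M> + e/2"
    using inner_approx[of "e/2" U] \<open>0 < e\<close> by auto
  obtain \<N> where N: "closed_family \<N>" "\<Union>\<N> \<subseteq> V" "inner V < sum mass \<N> + e/2"
    using inner_approx[of "e/2" V] \<open>0 < e\<close> by auto
  have disj: "\<Union>\<M> \<inter> \<Union>\<N> = {}" using assms M(2) N(2) by blast
  note u = closed_family_Un[OF M(1) N(1) disj]
  have "sum mass (\<M> \<union> \<N>) = sum mass \<M> + sum mass \<N>"
    using M(1) N(1) u(2) unfolding closed_family_def by (intro sum.union_disjoint) auto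
  moreover have "sum mass (\<M> \<union> \<N>) \<le> inner (U \<union> V)"
    using M(2) N(2) by (intro inner_upper u(1)) auto
  ultimately show "inner U + inner V \<le> inner (U \<union> V) + e" using M(3) N(3) by simp
qed

lemma inner_Un_open:
  assumes "openin Y U" "openin Y V" "U \<inter> V = {}"
  shows "inner (U \<union> V) = inner U + inner V"
proof (rule antisym[OF _ inner_superadditive[OF assms(3)]], rule inner_least)
  fix \<N> assume N: "closed_family \<N>" "\<Union>\<N> \<subseteq> U \<union> V"
  define \<N>U where "\<N>U = {N\<in>\<N>. N \<subseteq> U}"
  define \<N>V where "\<N>V = \<N> - \<N>U"
  have split: "N \<subseteq> U \<or> N \<subseteq> V" if "N \<in> \<N>" for N
  proof -
    have "connectedin Y N" "N \<subseteq> U \<union> V" using N that unfolding closed_family_def by auto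
    then have "U \<inter> N = {} \<or> V \<inter> N = {}"
      using connectedinD[OF _ assms(1,2), of N] assms(3) by auto
    then show ?thesis using \<open>N \<subseteq> U \<union> V\<close> by auto
  qed
  have "sum mass \<N> = sum mass \<N>U + sum mass \<N>V"
    unfolding \<N>V_def \<N>U_def using N(1) unfolding closed_family_def
    by (simp add: sum.subset_diff[of "{N\<in>\<N>. N \<subseteq> U}" \<N>])
  moreover have "sum mass \<N>U \<le> inner U"
    by (rule inner_upper) (use closed_family_subset[OF N(1), of \<N>U] in \<open>auto simp: \<N>U_def\<close>)
  moreover have "sum mass \<N>V \<le> inner V"
    by (rule inner_upper) (use closed_family_subset[OF N(1), of \<N>V] split in \<open>auto simp: \<N>U_def \<N>V_def\<close>)
  ultimately show "sum mass \<N> \<le> inner U + inner V" by simp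
qed

lemma sum_inner_le:
  assumes "finite \<W>" "pairwise disjnt \<W>"
  shows "(\<Sum>W\<in>\<W>. inner W) \<le> inner (\<Union>\<W>)"
  using assms
proof (induction \<W>)
  case (insert W \<W>)
  then have "\<And>V. V \<in> \<W> \<Longrightarrow> disjnt W V" by (auto simp: pairwise_insert)
  then have "W \<inter> \<Union>\<W> = {}" by (auto simp: disjnt_def)
  then have "inner W + inner (\<Union>\<W>) \<le> inner (\<Union>(insert W \<W>))"
    using inner_superadditive[of W "\<Union>\<W>"] by simp
  then show ?case using insert by (simp add: pairwise_insert)
qed (simp add: inner_empty)

text \<open>
  Enlarge the holes of \<open>W\<close> to disjoint closed solid neighbourhoods of almost the same weight. By genus
  zero the complement of the enlarged holes is connected, so its closure \<open>C\<close> is one of the sets that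
  the inner measure of \<open>W\<close> takes into account. The components of the complement of \<open>C\<close> lie inside the
  enlarged holes, and superadditivity shows that \<open>C\<close> has lost almost no mass.
\<close>

lemma mass_le_inner:
  assumes W: "finitely_holed W" and ne: "W \<noteq> {}"
  shows "mass W \<le> inner W"
proof (rule field_le_epsilon)
  fix e :: real assume e: "0 < e"
  let ?S = "topspace Y"
  let ?\<H> = "comps Y (?S - W)"
  have WS: "W \<subseteq> ?S" and fin: "finite ?\<H>"
    and hole: "\<And>H. H \<in> ?\<H> \<Longrightarrow> closedin Y H \<and> solid_in Y H"
    using W unfolding finitely_holed_def by auto
  have UH: "\<Union>?\<H> = ?S - W" by (rule Union_comps) blast
  \<comment> \<open>the enlarged holes will avoid this point, which keeps their complement nonempty\<close>
  obtain w where w: "w \<in> W" using ne by blast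
  define d where "d = e / (real (card ?\<H>) + 1)"
  have d: "0 < d" "real (card ?\<H>) * d \<le> e" using e unfolding d_def by (auto simp: field_simps)
  have "\<And>H. H \<in> ?\<H> \<Longrightarrow> compactin Y H" using hole compact closedin_compact_space by blast
  from Hausdorff_disjoint_neighbourhoods[OF Hausdorff fin comps_disjnt this]
  obtain V where V: "\<forall>H\<in>?\<H>. openin Y (V H) \<and> H \<subseteq> V H"
    "\<forall>H\<in>?\<H>. \<forall>L\<in>?\<H>. H \<noteq> L \<longrightarrow> disjnt (V H) (V L)"
    by auto
  have "\<exists>G. closedin Y G \<and> solid_in Y G \<and> G \<subseteq> V H - {w} \<and> lam G \<le> lam H + d \<and>
      (\<exists>U. openin Y U \<and> H \<subseteq> U \<and> U \<subseteq> G)" if H: "H \<in> ?\<H>" for H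
  proof -
    have "closedin Y {w}"
      using w WS Hausdorff by (simp add: closedin_Hausdorff_singleton subset_iff)
    then have "openin Y (V H - {w})" using V(1) H by (intro openin_diff) auto
    moreover have "H \<subseteq> V H - {w}" using V(1) H compsD(3)[OF H] w by auto
    ultimately obtain V' where V': "openin Y V'" "H \<subseteq> V'" "V' \<subseteq> V H - {w}" "lam V' < lam H + d"
      using lam_outer_regular[of H "V H - {w}" d] hole[OF H] d(1) by auto
    obtain G U where G: "closedin Y G" "solid_in Y G" "openin Y U" "H \<subseteq> U" "U \<subseteq> G" "G \<subseteq> V'"
      using solid_enlargement[OF compact Hausdorff connected locally_connected, of H V'] hole[OF H] compsD(2)[OF H] V' by metis
    have "lam G \<le> lam V'" using G V' by (intro lam_mono) (auto simp: open_or_closed_in_def)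
    then have "closedin Y G \<and> solid_in Y G \<and> G \<subseteq> V H - {w} \<and> lam G \<le> lam H + d \<and>
      (\<exists>U. openin Y U \<and> H \<subseteq> U \<and> U \<subseteq> G)"
      using G V' by auto
    then show ?thesis by (rule exI)
  qed
  then have "\<forall>H\<in>?\<H>. \<exists>G. closedin Y G \<and> solid_in Y G \<and> G \<subseteq> V H - {w} \<and> lam G \<le> lam H + d \<and>
      (\<exists>U. openin Y U \<and> H \<subseteq> U \<and> U \<subseteq> G)" by (rule ballI)
  from bchoice[OF this] obtain g where g': "\<forall>H\<in>?\<H>. closedin Y (g H) \<and> solid_in Y (g H) \<and> g H \<subseteq> V H - {w} \<and>
      lam (g H) \<le> lam H + d \<and> (\<exists>U. openin Y U \<and> H \<subseteq> U \<and> U \<subseteq> g H)" by (rule exE)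
  have g: "closedin Y (g H)" "solid_in Y (g H)" "g H \<subseteq> V H - {w}" "lam (g H) \<le> lam H + d"
      "\<exists>U. openin Y U \<and> H \<subseteq> U \<and> U \<subseteq> g H" if "H \<in> ?\<H>" for H
    using g'[rule_format, OF that] by simp_all
  let ?\<G> = "g ` ?\<H>"
  have finG: "finite ?\<G>" using fin by simp
  have disjG: "pairwise disjnt ?\<G>"
  proof (rule pairwiseI)
    fix A B assume "A \<in> ?\<G>" "B \<in> ?\<G>" "A \<noteq> B"
    then obtain H L where HL: "H \<in> ?\<H>" "L \<in> ?\<H>" "H \<noteq> L" "A = g H" "B = g L" by auto
    then have "disjnt (V H) (V L)" using V(2) by blast
    then show "disjnt A B"
      using g(3)[OF HL(1)] g(3)[OF HL(2)] HL(4,5) unfolding disjnt_def by blast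
  qed
  have neG: "G \<noteq> {}" if G: "G \<in> ?\<G>" for G
  proof -
    obtain H where H: "H \<in> ?\<H>" "G = g H" using G by (rule imageE)
    then show ?thesis using g(5)[OF H(1)] compsD(2)[OF H(1)] by blast
  qed
  have GS: "closedin Y G \<and> solid_in Y G" if "G \<in> ?\<G>" for G using that g(1,2) by auto
  define C where "C = Y closure_of (?S - \<Union>?\<G>)"
  have "connectedin Y (?S - \<Union>?\<G>)"
    by (rule connected_complement_solids[OF finG disjG GS])
  then have Cconn: "connectedin Y C" unfolding C_def by (rule connectedin_closure_of)
  have Ccl: "closedin Y C" unfolding C_def by simp
  have sub: "?S - \<Union>?\<G> \<subseteq> C" unfolding C_def by (rule closure_of_subset) blast
  have "w \<in> ?S - \<Union>?\<G>" using w WS g(3) by auto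
  then have Cne: "C \<noteq> {}" using sub by blast
  have CW: "C \<subseteq> W"
  proof
    fix x assume x: "x \<in> C"
    show "x \<in> W"
    proof (rule ccontr)
      assume "x \<notin> W"
      moreover have "x \<in> ?S" using x Ccl closedin_subset by blast
      ultimately obtain H where H: "H \<in> ?\<H>" "x \<in> H" using UH by blast
      obtain U where U: "openin Y U" "H \<subseteq> U" "U \<subseteq> g H" using g(5)[OF H(1)] by blast
      then have "x \<in> U" using H by blast
      then obtain y where "y \<in> ?S - \<Union>?\<G>" "y \<in> U"
        using x U(1) unfolding C_def in_closure_of by blast
      then show False using U(3) H(1) by blast
    qed
  qed
  have cG: "comps Y (\<Union>?\<G>) = ?\<G>"
    by (rule comps_eqI_closed[OF finG disjG]) (use GS neG in \<open>auto simp: solid_in_def\<close>)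
  \<comment> \<open>a connected subset of a finite disjoint union of closed connected sets lies in one of them\<close>
  have in_one: "\<exists>G\<in>?\<G>. U \<subseteq> G" if U: "U \<in> comps Y (?S - C)" for U
  proof -
    have "U \<subseteq> \<Union>?\<G>" using compsD(3)[OF U] sub by blast
    then obtain G where "G \<in> comps Y (\<Union>?\<G>)" "U \<subseteq> G"
      by (rule comps_superset[OF compsD(1,2)[OF U]])
    then show ?thesis unfolding cG by blast
  qed
  then obtain h where h: "\<And>U. U \<in> comps Y (?S - C) \<Longrightarrow> h U \<in> ?\<G> \<and> U \<subseteq> h U" by metis
  have opU: "open_or_closed_in Y U" if "U \<in> comps Y (?S - C)" for U
    using openin_comps[OF locally_connected openin_diff[OF openin_topspace Ccl] that]
    unfolding open_or_closed_in_def by simp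
  have "lam ?S - mass C \<le> sum lam ?\<H> + e"
  proof (rule has_sum_le_finite_sums[OF lam_has_sum_mass[OF Ccl Cconn Cne]])
    fix F assume F: "finite F" "F \<subseteq> comps Y (?S - C)"
    have "sum lam F = (\<Sum>G\<in>?\<G>. sum lam {U\<in>F. h U = G})"
    proof (rule sum.group[OF F(1) finG, symmetric])
      show "h ` F \<subseteq> ?\<G>"
      proof
        fix G assume "G \<in> h ` F"
        then obtain U where U: "U \<in> F" "G = h U" by (rule imageE)
        then show "G \<in> ?\<G>" using h[of U] F(2) by auto
      qed
    qed
    also have "\<dots> \<le> (\<Sum>G\<in>?\<G>. lam G)"
    proof (rule sum_mono)
      fix G assume G: "G \<in> ?\<G>"
      show "sum lam {U\<in>F. h U = G} \<le> lam G"
      proof (rule lam_superadditive)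
        show "pairwise disjnt {U\<in>F. h U = G}"
          by (rule pairwise_subset[OF comps_disjnt[of Y "?S - C"]]) (use F in auto)
        show "\<Union>{U\<in>F. h U = G} \<subseteq> G"
        proof (rule Union_least)
          fix U assume "U \<in> {U\<in>F. h U = G}"
          then show "U \<subseteq> G" using h[of U] F(2) by auto
        qed
      qed (use F opU GS[OF G] in \<open>auto simp: open_or_closed_in_def\<close>)
    qed
    also have "\<dots> \<le> (\<Sum>H\<in>?\<H>. lam (g H))"
      using sum_image_le[OF fin, of lam g] g(1) lam_nonneg by (auto simp: open_or_closed_in_def o_def)
    also have "\<dots> \<le> (\<Sum>H\<in>?\<H>. lam H + d)" by (rule sum_mono) (rule g(4))
    also have "\<dots> \<le> sum lam ?\<H> + e" using d(2) by (simp add: sum.distrib)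
    finally show "sum lam F \<le> sum lam ?\<H> + e" .
  qed
  then have "mass W \<le> mass C + e" using mass_finitely_holed[OF W] by simp
  moreover have "closed_family {C}" unfolding closed_family_def using Ccl Cconn Cne by simp
  then have "mass C \<le> inner W" using inner_upper[of "{C}" W] CW by simp
  ultimately show "mass W \<le> inner W + e" by simp
qed

text \<open>
  One inequality holds because families inside the complement can be joined to \<open>\<N>\<close>, the other because
  the masses of the components of the complement add up to the right-hand side.
\<close>

lemma inner_complement_family:
  assumes "closed_family \<N>"
  shows "inner (topspace Y - \<Union>\<N>) = lam (topspace Y) - sum mass \<N>"
proof (rule antisym)
  let ?S = "topspace Y"
  have NS: "\<Union>\<N> \<subseteq> ?S" using closed_family_closedin[OF assms] closedin_subset by blast
  have "inner (?S - \<Union>\<N>) + inner (\<Union>\<N>) \<le> inner ((?S - \<Union>\<N>) \<union> \<Union>\<N>)"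
    by (rule inner_superadditive) blast
  moreover have "(?S - \<Union>\<N>) \<union> \<Union>\<N> = ?S" using NS by blast
  moreover have "sum mass \<N> \<le> inner (\<Union>\<N>)" by (rule inner_upper[OF assms subset_refl])
  ultimately show "inner (?S - \<Union>\<N>) \<le> lam ?S - sum mass \<N>" by (simp add: inner_topspace)
  note I = mass_has_sum_complement[OF assms]
  show "lam ?S - sum mass \<N> \<le> inner (?S - \<Union>\<N>)"
  proof (rule has_sum_le_finite_sums[OF conjunct1[OF I]])
    fix F assume F: "finite F" "F \<subseteq> comps Y (?S - \<Union>\<N>)"
    have "sum mass F \<le> (\<Sum>W\<in>F. inner W)"
    proof (rule sum_mono)
      fix W assume "W \<in> F"
      then have W: "W \<in> comps Y (?S - \<Union>\<N>)" using F by blast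
      show "mass W \<le> inner W" using mass_le_inner I W compsD(2)[OF W] by blast
    qed
    also have "\<dots> \<le> inner (\<Union>F)"
      by (rule sum_inner_le[OF F(1) pairwise_subset[OF comps_disjnt F(2)]])
    also have "\<dots> \<le> inner (?S - \<Union>\<N>)"
      by (rule inner_mono) (use F(2) compsD(3)[of _ Y "?S - \<Union>\<N>"] in blast)
    finally show "sum mass F \<le> inner (?S - \<Union>\<N>)" .
  qed
qed

text \<open>
  This says that the open sets \<open>V\<close> and \<open>Y - K\<close>, which cover the space, have together at least the full
  measure. It is the one inequality that superadditivity cannot give, and it makes the inner measure
  additive for a closed set and its complement.
\<close>

lemma outer_le_inner:
  assumes "closedin Y K" "openin Y V" "K \<subseteq> V"
  shows "lam (topspace Y) - inner (topspace Y - K) \<le> inner V"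
proof -
  obtain \<N> where N: "closed_family \<N>" "K \<subseteq> \<Union>\<N>" "\<Union>\<N> \<subseteq> V"
    by (rule finite_closed_connected_cover[OF assms])
  have "inner (topspace Y - \<Union>\<N>) \<le> inner (topspace Y - K)" by (rule inner_mono) (use N in blast)
  then show ?thesis using inner_complement_family[OF N(1)] inner_upper[OF N(1,3)] by simp
qed

lemma outer_approx:
  assumes K: "closedin Y K" and "0 < e"
  obtains V where "openin Y V" "K \<subseteq> V" "inner V < lam (topspace Y) - inner (topspace Y - K) + e"
proof -
  obtain \<N> where N: "closed_family \<N>" "\<Union>\<N> \<subseteq> topspace Y - K"
    "inner (topspace Y - K) < sum mass \<N> + e" using inner_approx[OF \<open>0 < e\<close>] by metis
  show ?thesis
  proof (rule that)
    show "openin Y (topspace Y - \<Union>\<N>)" using closed_family_closedin[OF N(1)] by blast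
    show "K \<subseteq> topspace Y - \<Union>\<N>" using N(2) closedin_subset[OF K] by blast
    show "inner (topspace Y - \<Union>\<N>) < lam (topspace Y) - inner (topspace Y - K) + e"
      using inner_complement_family[OF N(1)] N(3) by simp
  qed
qed

text \<open>
  By the two preceding lemmas this is also the infimum of the inner measures of the open
  neighbourhoods of \<open>K\<close>, if \<open>K\<close> is closed.
\<close>

definition outer :: "'b set \<Rightarrow> real" where
  "outer K = lam (topspace Y) - inner (topspace Y - K)"

lemma outer_family: "closed_family \<N> \<Longrightarrow> outer (\<Union>\<N>) = sum mass \<N>"
  unfolding outer_def by (simp add: inner_complement_family)

lemma inner_family_le: "closed_family \<N> \<Longrightarrow> inner (\<Union>\<N>) \<le> sum mass \<N>"
  using inner_superadditive[of "\<Union>\<N>" "topspace Y - \<Union>\<N>"] inner_complement_family[of \<N>]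
    closedin_subset[OF closed_family_closedin, of \<N>]
  by (simp add: inner_topspace Un_absorb1)

text \<open>
  Disjoint closed sets have disjoint open neighbourhoods, and for these the inner measure is additive.
\<close>

lemma outer_Un_closed:
  assumes K: "closedin Y K" and L: "closedin Y L" and disj: "disjnt K L"
  shows "outer (K \<union> L) = outer K + outer L"
proof -
  have cpt: "compactin Y K" "compactin Y L" using K L compact closedin_compact_space by blast+
  obtain A B where AB: "openin Y A" "openin Y B" "K \<subseteq> A" "L \<subseteq> B" "disjnt A B"
    using Hausdorff_space_compact_separation[OF Hausdorff cpt disj] .
  have KL: "closedin Y (K \<union> L)" using K L by (rule closedin_Un)
  have split: "outer K + outer L \<le> inner V" if V: "openin Y V" "K \<union> L \<subseteq> V" for V
  proof -
    have "outer K \<le> inner (A \<inter> V)" "outer L \<le> inner (B \<inter> V)"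
      unfolding outer_def using V AB K L by (auto intro!: outer_le_inner)
    moreover have "inner (A \<inter> V) + inner (B \<inter> V) \<le> inner ((A \<inter> V) \<union> (B \<inter> V))"
      by (rule inner_superadditive) (use AB(5) in \<open>auto simp: disjnt_def\<close>)
    moreover have "\<dots> \<le> inner V" by (rule inner_mono) auto
    ultimately show ?thesis by simp
  qed
  show ?thesis
  proof (rule antisym)
    show "outer (K \<union> L) \<le> outer K + outer L"
    proof (rule field_le_epsilon)
      fix e :: real assume "0 < e"
      then have e2: "0 < e/2" by simp
      obtain V where V: "openin Y V" "K \<subseteq> V" "inner V < outer K + e/2"
        using outer_approx[OF K e2] unfolding outer_def by metis
      obtain W where W: "openin Y W" "L \<subseteq> W" "inner W < outer L + e/2"
        using outer_approx[OF L e2] unfolding outer_def by metis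
      have "outer (K \<union> L) \<le> inner ((V \<inter> A) \<union> (W \<inter> B))"
        unfolding outer_def using V W AB by (intro outer_le_inner[OF KL]) auto
      also have "\<dots> = inner (V \<inter> A) + inner (W \<inter> B)"
        using V W AB by (intro inner_Un_open) (auto simp: disjnt_def)
      also have "\<dots> \<le> inner V + inner W" by (intro add_mono inner_mono) auto
      finally show "outer (K \<union> L) \<le> outer K + outer L + e" using V(3) W(3) by simp
    qed
    show "outer K + outer L \<le> outer (K \<union> L)"
    proof (rule field_le_epsilon)
      fix e :: real assume "0 < e"
      obtain V where "openin Y V" "K \<union> L \<subseteq> V" "inner V < outer (K \<union> L) + e"
        using outer_approx[OF KL \<open>0 < e\<close>] unfolding outer_def by metis
      then show "outer K + outer L \<le> outer (K \<union> L) + e" using split[of V] by simp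
    qed
  qed
qed

lemma inner_Diff_closed:
  assumes K: "closedin Y K" and U: "openin Y U" and "K \<subseteq> U"
  shows "inner U = outer K + inner (U - K)"
proof -
  have US: "U \<subseteq> topspace Y" using U openin_subset by blast
  have "outer (K \<union> (topspace Y - U)) = outer K + outer (topspace Y - U)"
    by (rule outer_Un_closed) (use assms in \<open>auto simp: disjnt_def\<close>)
  moreover have "topspace Y - (K \<union> (topspace Y - U)) = U - K" "topspace Y - (topspace Y - U) = U"
    using US by auto
  ultimately show ?thesis unfolding outer_def by simp
qed

lemma outer_Diff_closed:
  assumes K: "closedin Y K" and C: "closedin Y C" and "K \<subseteq> C" "openin Y (C - K)"
  shows "outer C = outer K + inner (C - K)"
proof -
  have "topspace Y - K = (C - K) \<union> (topspace Y - C)"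
    using assms(3) closedin_subset[OF C] by auto
  then have "inner (topspace Y - K) = inner (C - K) + inner (topspace Y - C)"
    using inner_Un_open[OF assms(4), of "topspace Y - C"] C by auto
  then show ?thesis unfolding outer_def by simp
qed

end

section \<open>Positive and negative variation\<close>

text \<open>
  For a real signed topological measure \<open>r\<close> these are its positive variation on open sets and the
  outer regular extension to arbitrary sets. The negative variation is obtained from \<open>- r\<close>.
\<close>

definition variation :: "'a topology \<Rightarrow> ('a set \<Rightarrow> real) \<Rightarrow> 'a set \<Rightarrow> real" where
  "variation X r U = (SUP K\<in>{K. compactin X K \<and> K \<subseteq> U}. r K)"

definition outer_variation :: "'a topology \<Rightarrow> ('a set \<Rightarrow> real) \<Rightarrow> 'a set \<Rightarrow> real" where
  "outer_variation X r A = (INF V\<in>{V. openin X V \<and> A \<subseteq> V}. variation X r V)"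

text \<open>
  A signed topological measure of finite norm with its values read as reals. The two limits along nets
  are written with explicit tolerances.
\<close>

locale finite_signed_topological_measure =
  fixes X :: "'a topology" and r :: "'a set \<Rightarrow> real"
  assumes Hausdorff_X: "Hausdorff_space X"
    and additive: "\<And>A B. open_or_compact_in X A \<Longrightarrow> open_or_compact_in X B \<Longrightarrow> open_or_compact_in X (A \<union> B) \<Longrightarrow>
      disjnt A B \<Longrightarrow> r (A \<union> B) = r A + r B"
    and inner_limit: "\<And>U e. openin X U \<Longrightarrow> 0 < e \<Longrightarrow>
      \<exists>K. compactin X K \<and> K \<subseteq> U \<and> (\<forall>L. compactin X L \<and> K \<subseteq> L \<and> L \<subseteq> U \<longrightarrow> \<bar>r L - r U\<bar> < e)"
    and outer_limit: "\<And>F e. closedin X F \<Longrightarrow> 0 < e \<Longrightarrow>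
      \<exists>U. openin X U \<and> F \<subseteq> U \<and> (\<forall>V. openin X V \<and> F \<subseteq> V \<and> V \<subseteq> U \<longrightarrow> \<bar>r V - r F\<bar> < e)"
    and bounded: "\<exists>B. \<forall>K. compactin X K \<longrightarrow> \<bar>r K\<bar> \<le> B"
begin

lemma negative: "finite_signed_topological_measure X (\<lambda>A. - r A)"
proof
  show "- r (A \<union> B) = - r A + - r B"
    if "open_or_compact_in X A" "open_or_compact_in X B" "open_or_compact_in X (A \<union> B)" "disjnt A B" for A B
    using additive[OF that] by simp
  have *: "\<bar>- a - - b\<bar> = \<bar>a - b\<bar>" for a b :: real by simp
  show "\<exists>K. compactin X K \<and> K \<subseteq> U \<and> (\<forall>L. compactin X L \<and> K \<subseteq> L \<and> L \<subseteq> U \<longrightarrow> \<bar>- r L - - r U\<bar> < e)"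
    if "openin X U" "0 < e" for U e
    unfolding * by (rule inner_limit[OF that])
  show "\<exists>U. openin X U \<and> F \<subseteq> U \<and> (\<forall>V. openin X V \<and> F \<subseteq> V \<and> V \<subseteq> U \<longrightarrow> \<bar>- r V - - r F\<bar> < e)"
    if "closedin X F" "0 < e" for F e
    unfolding * by (rule outer_limit[OF that])
qed (use Hausdorff_X bounded in simp_all)

lemma r_empty: "r {} = 0"
  using additive[of "{}" "{}"] by (simp add: open_or_compact_in_def)

lemma r_UN_open:
  assumes "finite I" "\<And>i. i \<in> I \<Longrightarrow> openin X (f i)" "disjoint_family_on f I"
  shows "r (\<Union>i\<in>I. f i) = (\<Sum>i\<in>I. r (f i))"
  using assms
proof (induction I)
  case (insert i I)
  have "openin X (\<Union>j\<in>I. f j)" using insert.prems(1) by auto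
  moreover have "disjnt (f i) (\<Union>j\<in>I. f j)"
    using insert.prems(2) insert.hyps(2) unfolding disjoint_family_on_def disjnt_def by auto
  ultimately have "r (f i \<union> (\<Union>j\<in>I. f j)) = r (f i) + r (\<Union>j\<in>I. f j)"
    using insert.prems(1) by (intro additive) (auto simp: open_or_compact_in_def)
  then show ?case using insert by (simp add: disjoint_family_on_insert)
qed (simp add: r_empty)

lemma r_UN_compact:
  assumes "finite I" "\<And>i. i \<in> I \<Longrightarrow> compactin X (f i)" "disjoint_family_on f I"
  shows "r (\<Union>i\<in>I. f i) = (\<Sum>i\<in>I. r (f i))"
  using assms
proof (induction I)
  case (insert i I)
  have "compactin X (\<Union>j\<in>I. f j)" using insert.prems(1) insert.hyps(1) by (intro compactin_Union) auto
  moreover have "disjnt (f i) (\<Union>j\<in>I. f j)"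
    using insert.prems(2) insert.hyps(2) unfolding disjoint_family_on_def disjnt_def by auto
  ultimately have "r (f i \<union> (\<Union>j\<in>I. f j)) = r (f i) + r (\<Union>j\<in>I. f j)"
    using insert.prems(1) by (intro additive) (auto simp: open_or_compact_in_def intro: compactin_Un)
  then show ?case using insert by (simp add: disjoint_family_on_insert)
qed (simp add: r_empty)

text \<open>
  A compact set \<open>K\<close> that approximates the union from inside is covered by finitely many members. Every
  finite subunion that contains these lies between \<open>K\<close> and the whole union, so its value is close to
  that of the union.
\<close>

lemma r_has_sum_disjoint_open:
  assumes op: "\<And>i. i \<in> I \<Longrightarrow> openin X (f i)" and disj: "disjoint_family_on f I"
  shows "((\<lambda>i. r (f i)) has_sum r (\<Union>i\<in>I. f i)) I"
  unfolding has_sum_def tendsto_iff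
proof (intro allI impI)
  fix e :: real assume "0 < e"
  then have e2: "0 < e/2" by simp
  let ?U = "\<Union>i\<in>I. f i"
  have U: "openin X ?U" using op by auto
  obtain K where K: "compactin X K" "K \<subseteq> ?U"
    "\<forall>L. compactin X L \<and> K \<subseteq> L \<and> L \<subseteq> ?U \<longrightarrow> \<bar>r L - r ?U\<bar> < e/2"
    using inner_limit[OF U e2] by auto
  obtain \<F> where "finite \<F>" "\<F> \<subseteq> f ` I" "K \<subseteq> \<Union>\<F>"
    using compactinD[OF K(1), of "f ` I"] op K(2) by auto
  then obtain J where J: "J \<subseteq> I" "finite J" "K \<subseteq> (\<Union>i\<in>J. f i)"
    using finite_subset_image[of \<F> f I] by auto
  have "dist (\<Sum>i\<in>F. r (f i)) (r ?U) < e" if F: "finite F" "J \<subseteq> F" "F \<subseteq> I" for F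
  proof -
    let ?V = "\<Union>i\<in>F. f i"
    have V: "openin X ?V" using op F by auto
    obtain L where L: "compactin X L" "L \<subseteq> ?V"
      "\<forall>M. compactin X M \<and> L \<subseteq> M \<and> M \<subseteq> ?V \<longrightarrow> \<bar>r M - r ?V\<bar> < e/2"
      using inner_limit[OF V e2] by auto
    have KV: "K \<subseteq> ?V" using J F by blast
    have VU: "?V \<subseteq> ?U" using F by blast
    have cpt: "compactin X (K \<union> L)" using K L by (intro compactin_Un)
    have "\<bar>r (K \<union> L) - r ?V\<bar> < e/2" using L(3) L(2) KV cpt by simp
    moreover have "\<bar>r (K \<union> L) - r ?U\<bar> < e/2" using K(3,2) L(2) VU cpt by simp
    moreover have "(\<Sum>i\<in>F. r (f i)) = r ?V"
      using F op disj by (intro r_UN_open[symmetric]) (auto intro: disjoint_family_on_mono)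
    ultimately show ?thesis unfolding dist_real_def by linarith
  qed
  then show "\<forall>\<^sub>F F in finite_subsets_at_top I. dist (\<Sum>i\<in>F. r (f i)) (r ?U) < e"
    using J unfolding eventually_finite_subsets_at_top by (intro exI[of _ J]) auto
qed

abbreviation "var \<equiv> variation X r"
abbreviation "pos \<equiv> outer_variation X r"

lemma var_bdd: "bdd_above (r ` {K. compactin X K \<and> K \<subseteq> U})"
proof -
  obtain B where B: "\<forall>K. compactin X K \<longrightarrow> \<bar>r K\<bar> \<le> B" using bounded by blast
  show ?thesis by (rule bdd_aboveI2[of _ _ B]) (use B in \<open>auto simp: abs_le_iff\<close>)
qed

lemma var_upper: "compactin X K \<Longrightarrow> K \<subseteq> U \<Longrightarrow> r K \<le> var U"
  unfolding variation_def by (rule cSUP_upper[OF _ var_bdd]) simp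

lemma var_least: "(\<And>K. compactin X K \<Longrightarrow> K \<subseteq> U \<Longrightarrow> r K \<le> c) \<Longrightarrow> var U \<le> c"
  unfolding variation_def using compactin_empty[of X] by (intro cSUP_least) auto

lemma var_mono: "U \<subseteq> V \<Longrightarrow> var U \<le> var V"
  by (intro var_least var_upper) auto

lemma var_nonneg: "0 \<le> var U"
  using var_upper[of "{}" U] by (simp add: r_empty)

lemma var_approx:
  assumes "0 < e"
  shows "\<exists>K. compactin X K \<and> K \<subseteq> U \<and> var U < r K + e"
proof (rule ccontr)
  assume *: "\<not> ?thesis"
  have "var U \<le> var U - e"
  proof (rule var_least)
    fix K assume "compactin X K" "K \<subseteq> U"
    then have "\<not> var U < r K + e" using * by simp
    then show "r K \<le> var U - e" by simp
  qed
  then show False using assms by simp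
qed

lemma pos_lower: "openin X V \<Longrightarrow> A \<subseteq> V \<Longrightarrow> pos A \<le> var V"
  unfolding outer_variation_def
  by (rule cINF_lower) (auto intro!: bdd_belowI2[of _ 0] var_nonneg)

lemma pos_greatest:
  "A \<subseteq> topspace X \<Longrightarrow> (\<And>V. openin X V \<Longrightarrow> A \<subseteq> V \<Longrightarrow> c \<le> var V) \<Longrightarrow> c \<le> pos A"
  unfolding outer_variation_def by (intro cINF_greatest) auto

lemma pos_open: "openin X U \<Longrightarrow> pos U = var U"
  by (intro antisym pos_lower pos_greatest var_mono) (auto simp: openin_subset)

lemma pos_approx:
  assumes "A \<subseteq> topspace X" "0 < e"
  shows "\<exists>V. openin X V \<and> A \<subseteq> V \<and> var V < pos A + e"
proof (rule ccontr)
  assume *: "\<not> ?thesis"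
  have "pos A + e \<le> pos A"
  proof (rule pos_greatest[OF assms(1)])
    fix V assume "openin X V" "A \<subseteq> V"
    then have "\<not> var V < pos A + e" using * by simp
    then show "pos A + e \<le> var V" by simp
  qed
  then show False using assms by simp
qed

lemma pos_nonneg: "A \<subseteq> topspace X \<Longrightarrow> 0 \<le> pos A"
  by (rule pos_greatest) (auto intro: var_nonneg)

lemma pos_empty: "pos {} = 0"
proof -
  have "var {} = 0" by (rule antisym[OF var_least var_nonneg]) (simp add: r_empty)
  then show ?thesis by (simp add: pos_open)
qed

lemma pos_mono: "A \<subseteq> B \<Longrightarrow> B \<subseteq> topspace X \<Longrightarrow> pos A \<le> pos B"
  by (intro pos_greatest pos_lower) auto

lemma compact_le_pos: "compactin X K \<Longrightarrow> r K \<le> pos K"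
  by (intro pos_greatest var_upper) (auto dest: compactin_subset_topspace)

text \<open>
  Disjoint neighbourhoods of the members inside \<open>V\<close> contain compact sets \<open>f K\<close> that almost realise
  their variations, and \<open>r\<close> is additive on these.
\<close>

lemma pos_superadditive_compact:
  assumes fin: "finite \<K>" and disj: "pairwise disjnt \<K>" and cpt: "\<And>K. K \<in> \<K> \<Longrightarrow> compactin X K"
    and V: "openin X V" "\<Union>\<K> \<subseteq> V"
  shows "sum pos \<K> \<le> var V"
proof (rule field_le_epsilon)
  fix e :: real assume e: "0 < e"
  define d where "d = e / (real (card \<K>) + 1)"
  have d: "0 < d" "real (card \<K>) * d \<le> e" using e unfolding d_def by (auto simp: field_simps)
  obtain N where N: "\<forall>K\<in>\<K>. openin X (N K) \<and> K \<subseteq> N K"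
    "\<forall>K\<in>\<K>. \<forall>L\<in>\<K>. K \<noteq> L \<longrightarrow> disjnt (N K) (N L)"
    using Hausdorff_disjoint_neighbourhoods[OF Hausdorff_X fin disj cpt] by auto
  have "\<forall>K\<in>\<K>. \<exists>L. compactin X L \<and> L \<subseteq> N K \<inter> V \<and> var (N K \<inter> V) < r L + d"
  proof
    fix K
    show "\<exists>L. compactin X L \<and> L \<subseteq> N K \<inter> V \<and> var (N K \<inter> V) < r L + d" by (rule var_approx[OF d(1)])
  qed
  from bchoice[OF this] obtain f where f: "\<forall>K\<in>\<K>. compactin X (f K) \<and> f K \<subseteq> N K \<inter> V \<and> var (N K \<inter> V) < r (f K) + d"
    by (rule exE)
  have "sum pos \<K> \<le> (\<Sum>K\<in>\<K>. r (f K) + d)"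
  proof (rule sum_mono)
    fix K assume K: "K \<in> \<K>"
    have "pos K \<le> var (N K \<inter> V)" using N K V by (intro pos_lower openin_Int) auto
    then show "pos K \<le> r (f K) + d" using f K by fastforce
  qed
  also have "\<dots> = (\<Sum>K\<in>\<K>. r (f K)) + real (card \<K>) * d" by (simp add: sum.distrib)
  also have "(\<Sum>K\<in>\<K>. r (f K)) = r (\<Union>K\<in>\<K>. f K)"
  proof (rule r_UN_compact[symmetric, OF fin])
    show "disjoint_family_on f \<K>"
      unfolding disjoint_family_on_def
    proof (intro ballI impI)
      fix K L assume KL: "K \<in> \<K>" "L \<in> \<K>" "K \<noteq> L"
      then have "N K \<inter> N L = {}" using N(2) by (simp add: disjnt_def)
      moreover have "f K \<subseteq> N K" "f L \<subseteq> N L" using f KL by simp_all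
      ultimately show "f K \<inter> f L = {}" by blast
    qed
  qed (use f in simp)
  also have "\<dots> \<le> var V"
    using f fin by (intro var_upper compactin_Union) auto
  finally show "sum pos \<K> \<le> var V + e" using d(2) by simp
qed

text \<open>
  Open members are replaced by compact subsets with almost the same variation, which reduces the claim
  to compact families.
\<close>

lemma pos_superadditive:
  assumes fin: "finite \<A>" and disj: "pairwise disjnt \<A>" and oc: "\<And>A. A \<in> \<A> \<Longrightarrow> open_or_compact_in X A"
    and B: "B \<subseteq> topspace X" "\<Union>\<A> \<subseteq> B"
  shows "sum pos \<A> \<le> pos B"
proof (rule pos_greatest[OF B(1)], rule field_le_epsilon)
  fix V and e :: real assume V: "openin X V" "B \<subseteq> V" and e: "0 < e"
  define d where "d = e / (real (card \<A>) + 1)"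
  have d: "0 < d" "real (card \<A>) * d \<le> e" using e unfolding d_def by (auto simp: field_simps)
  have "\<forall>A\<in>\<A>. \<exists>K. compactin X K \<and> K \<subseteq> A \<and> pos A \<le> pos K + d"
  proof
    fix A assume A: "A \<in> \<A>"
    show "\<exists>K. compactin X K \<and> K \<subseteq> A \<and> pos A \<le> pos K + d"
    proof (cases "compactin X A")
      case True
      then show ?thesis using d(1) by (intro exI[of _ A]) simp
    next
      case False
      then have A': "openin X A" using oc[OF A] unfolding open_or_compact_in_def by simp
      obtain K where K: "compactin X K" "K \<subseteq> A" "var A < r K + d" using var_approx[OF d(1)] by blast
      then show ?thesis using compact_le_pos[OF K(1)] pos_open[OF A'] by (intro exI[of _ K]) simp
    qed
  qed
  from bchoice[OF this] obtain k where k: "\<forall>A\<in>\<A>. compactin X (k A) \<and> k A \<subseteq> A \<and> pos A \<le> pos (k A) + d"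
    by (rule exE)
  have kdisj: "disjnt (k A) (k A')" if A: "A \<in> \<A>" "A' \<in> \<A>" "A \<noteq> A'" for A A'
  proof -
    have "disjnt A A'" using pairwiseD[OF disj A] .
    moreover have "k A \<subseteq> A" "k A' \<subseteq> A'" using k A by simp_all
    ultimately show ?thesis unfolding disjnt_def by blast
  qed
  have "sum pos \<A> \<le> (\<Sum>A\<in>\<A>. pos (k A) + d)" by (rule sum_mono) (use k in simp)
  also have "\<dots> = (\<Sum>A\<in>\<A>. pos (k A)) + real (card \<A>) * d" by (simp add: sum.distrib)
  also have "(\<Sum>A\<in>\<A>. pos (k A)) = sum pos (k ` \<A>)"
  proof (rule sum.reindex_nontrivial[symmetric, unfolded o_def, OF fin])
    fix A A' assume "A \<in> \<A>" "A' \<in> \<A>" "A \<noteq> A'" "k A = k A'"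
    then have "k A = {}" using kdisj[of A A'] by (simp add: disjnt_def)
    then show "pos (k A) = 0" by (simp add: pos_empty)
  qed
  also have "\<dots> \<le> var V"
  proof (rule pos_superadditive_compact)
    show "pairwise disjnt (k ` \<A>)" using kdisj by (auto simp: pairwise_def)
    show "\<Union>(k ` \<A>) \<subseteq> V" using k B(2) V(2) by auto
  qed (use fin k V in auto)
  finally show "sum pos \<A> \<le> var V + e" using d(2) by simp
qed

text \<open>
  A compact \<open>K\<close> in \<open>U\<close> has \<open>r K = r U - r (U - K)\<close>, and \<open>r (U - K)\<close> is a limit of values \<open>r L\<close> on compact
  sets \<open>L\<close> inside \<open>U\<close>, so \<open>- r (U - K)\<close> is bounded by the negative variation.
\<close>

lemma var_le_r_plus_neg:
  assumes U: "openin X U"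
  shows "var U \<le> r U + variation X (\<lambda>A. - r A) U"
proof (rule var_least)
  interpret neg: finite_signed_topological_measure X "\<lambda>A. - r A" by (rule negative)
  fix K assume K: "compactin X K" "K \<subseteq> U"
  have UK: "openin X (U - K)" using U K Hausdorff_X by (intro openin_diff compactin_imp_closedin) auto
  have eq: "K \<union> (U - K) = U" using K(2) by auto
  have "r (K \<union> (U - K)) = r K + r (U - K)"
    using K U UK eq by (intro additive) (auto simp: open_or_compact_in_def disjnt_def)
  then have "r U = r K + r (U - K)" unfolding eq .
  moreover have "- r (U - K) \<le> variation X (\<lambda>A. - r A) U"
  proof (rule field_le_epsilon)
    fix e :: real assume "0 < e"
    obtain L where L: "compactin X L" "L \<subseteq> U - K" "\<bar>r L - r (U - K)\<bar> < e"
      using inner_limit[OF UK \<open>0 < e\<close>] by blast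
    have "- r L \<le> variation X (\<lambda>A. - r A) U" using L by (intro neg.var_upper) auto
    then show "- r (U - K) \<le> variation X (\<lambda>A. - r A) U + e" using L(3) by simp
  qed
  ultimately show "r K \<le> r U + variation X (\<lambda>A. - r A) U" by simp
qed

lemma var_minus_neg:
  assumes U: "openin X U"
  shows "var U - variation X (\<lambda>A. - r A) U = r U"
proof -
  interpret neg: finite_signed_topological_measure X "\<lambda>A. - r A" by (rule negative)
  show ?thesis using var_le_r_plus_neg[OF U] neg.var_le_r_plus_neg[OF U] by simp
qed

text \<open>
  Along the open neighbourhoods of \<open>C\<close> the values of \<open>f\<close> and \<open>g\<close> decrease to \<open>a\<close> and \<open>b\<close>, while the values of
  \<open>r\<close> converge to \<open>r C\<close>. The statement serves twice: for the variations, and at the end for the two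
  measures built from them.
\<close>

lemma difference_on_closed:
  fixes f g :: "'a set \<Rightarrow> real"
  assumes diff: "\<And>U. openin X U \<Longrightarrow> r U = f U - g U"
    and f: "\<And>U V. openin X U \<Longrightarrow> openin X V \<Longrightarrow> U \<subseteq> V \<Longrightarrow> f U \<le> f V"
    and g: "\<And>U V. openin X U \<Longrightarrow> openin X V \<Longrightarrow> U \<subseteq> V \<Longrightarrow> g U \<le> g V"
    and C: "closedin X C"
    and a: "\<And>V. openin X V \<Longrightarrow> C \<subseteq> V \<Longrightarrow> a \<le> f V" "\<And>e. 0 < e \<Longrightarrow> \<exists>V. openin X V \<and> C \<subseteq> V \<and> f V < a + e"
    and b: "\<And>V. openin X V \<Longrightarrow> C \<subseteq> V \<Longrightarrow> b \<le> g V" "\<And>e. 0 < e \<Longrightarrow> \<exists>V. openin X V \<and> C \<subseteq> V \<and> g V < b + e"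
  shows "r C = a - b"
proof -
  have close: "\<bar>r C - (a - b)\<bar> \<le> 2 * e" if e: "0 < e" for e
  proof -
    obtain U where U: "openin X U" "C \<subseteq> U" "\<forall>V. openin X V \<and> C \<subseteq> V \<and> V \<subseteq> U \<longrightarrow> \<bar>r V - r C\<bar> < e"
      using outer_limit[OF C e] by auto
    obtain V where V: "openin X V" "C \<subseteq> V" "f V < a + e" using a(2)[OF e] by auto
    obtain W where W: "openin X W" "C \<subseteq> W" "g W < b + e" using b(2)[OF e] by auto
    let ?O = "U \<inter> V \<inter> W"
    have O: "openin X ?O" "C \<subseteq> ?O" using U V W by auto
    have "\<bar>r ?O - r C\<bar> < e" using U(3) O by auto
    moreover have "a \<le> f ?O" "b \<le> g ?O" using a(1) b(1) O by auto
    moreover have "f ?O \<le> f V" by (rule f) (use O V in auto)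
    moreover have "g ?O \<le> g W" by (rule g) (use O W in auto)
    ultimately show ?thesis using diff[OF O(1)] V(3) W(3) by (simp add: abs_le_iff abs_less_iff)
  qed
  have "\<bar>r C - (a - b)\<bar> \<le> 0 + e" if "0 < e" for e using close[of "e/2"] that by simp
  then have "\<bar>r C - (a - b)\<bar> \<le> 0" by (rule field_le_epsilon)
  then show ?thesis by simp
qed

lemma pos_minus_neg:
  assumes C: "open_or_compact_in X C"
  shows "pos C - outer_variation X (\<lambda>A. - r A) C = r C"
proof -
  interpret neg: finite_signed_topological_measure X "\<lambda>A. - r A" by (rule negative)
  show ?thesis
  proof (cases "openin X C")
    case True
    then show ?thesis using var_minus_neg by (simp add: pos_open neg.pos_open)
  next
    case False
    then have C': "compactin X C" using C unfolding open_or_compact_in_def by simp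
    then have cl: "closedin X C" "C \<subseteq> topspace X"
      by (simp_all add: Hausdorff_X compactin_imp_closedin compactin_subset_topspace)
    have "r C = pos C - outer_variation X (\<lambda>A. - r A) C"
      by (rule difference_on_closed[of var "variation X (\<lambda>A. - r A)"])
        (use cl var_minus_neg in \<open>auto intro: var_mono neg.var_mono pos_lower neg.pos_lower pos_approx neg.pos_approx\<close>)
    then show ?thesis by simp
  qed
qed

end

section \<open>From the compactification back to the space\<close>

locale compactified_weight = complementary_weight "Alexandroff_compactification X" lam
  for X :: "'a topology" and lam :: "'a option set \<Rightarrow> real"
begin

lemma Hausdorff_base: "Hausdorff_space X"
  using Hausdorff by (simp add: Hausdorff_space_Alexandroff_compactification)

lemma closedin_image_Some: "compactin X K \<Longrightarrow> closedin (Alexandroff_compactification X) (Some ` K)"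
  using Hausdorff_base by (simp add: compactin_imp_closedin)

definition extension :: "'a set \<Rightarrow> real" where
  "extension A = (INF V\<in>{V. openin X V \<and> A \<subseteq> V}. inner (Some ` V))"

lemma extension_lower: "openin X V \<Longrightarrow> A \<subseteq> V \<Longrightarrow> extension A \<le> inner (Some ` V)"
  unfolding extension_def
  by (rule cINF_lower) (auto intro!: bdd_belowI2[of _ 0] inner_nonneg)

lemma extension_greatest:
  "A \<subseteq> topspace X \<Longrightarrow> (\<And>V. openin X V \<Longrightarrow> A \<subseteq> V \<Longrightarrow> c \<le> inner (Some ` V)) \<Longrightarrow> c \<le> extension A"
  unfolding extension_def by (intro cINF_greatest) auto

lemma extension_open: "openin X U \<Longrightarrow> extension U = inner (Some ` U)"
  by (intro antisym extension_lower extension_greatest inner_mono) (auto simp: openin_subset)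

lemma extension_nonneg: "A \<subseteq> topspace X \<Longrightarrow> 0 \<le> extension A"
  by (rule extension_greatest) (auto intro: inner_nonneg)

lemma extension_approx:
  assumes "A \<subseteq> topspace X" "0 < e"
  shows "\<exists>V. openin X V \<and> A \<subseteq> V \<and> inner (Some ` V) < extension A + e"
proof (rule ccontr)
  assume *: "\<not> ?thesis"
  have "extension A + e \<le> extension A"
  proof (rule extension_greatest[OF assms(1)])
    fix V assume "openin X V" "A \<subseteq> V"
    then have "\<not> inner (Some ` V) < extension A + e" using * by simp
    then show "extension A + e \<le> inner (Some ` V)" by simp
  qed
  then show False using assms by simp
qed

lemma extension_compact:
  assumes K: "compactin X K"
  shows "extension K = outer (Some ` K)"
proof (rule antisym)
  have KS: "K \<subseteq> topspace X" using K by (rule compactin_subset_topspace)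
  show "outer (Some ` K) \<le> extension K"
    unfolding outer_def
    by (intro extension_greatest[OF KS] outer_le_inner closedin_image_Some[OF K]) auto
  show "extension K \<le> outer (Some ` K)"
  proof (rule field_le_epsilon)
    fix e :: real assume "0 < e"
    obtain V where V: "openin (Alexandroff_compactification X) V" "Some ` K \<subseteq> V" "inner V < outer (Some ` K) + e"
      using outer_approx[OF closedin_image_Some[OF K] \<open>0 < e\<close>] unfolding outer_def by metis
    define V' where "V' = {x \<in> topspace X. Some x \<in> V}"
    have "openin X V'" unfolding V'_def
      using continuous_map_Some[of X] V(1) unfolding continuous_map_def by simp
    moreover have "K \<subseteq> V'" using V(2) KS unfolding V'_def by auto
    ultimately have "extension K \<le> inner (Some ` V')" by (rule extension_lower)
    also have "\<dots> \<le> inner V" by (rule inner_mono) (auto simp: V'_def)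
    finally show "extension K \<le> outer (Some ` K) + e" using V(3) by simp
  qed
qed

text \<open>
  Two open or two compact sets are covered by the additivity of the inner and of the outer measure. If
  \<open>U\<close> is open and \<open>K\<close> compact, then \<open>U\<close> arises by removing \<open>K\<close> from \<open>U \<union> K\<close>, an open or compact set.
\<close>

lemma extension_additive:
  assumes A: "open_or_compact_in X A" and B: "open_or_compact_in X B"
    and AB: "open_or_compact_in X (A \<union> B)" and disj: "disjnt A B"
  shows "extension (A \<union> B) = extension A + extension B"
proof -
  have mixed: "extension (U \<union> K) = extension U + extension K"
    if U: "openin X U" and K: "compactin X K" and UK: "open_or_compact_in X (U \<union> K)" and "disjnt U K" for U K
  proof -
    have eq: "U = (U \<union> K) - K" using that(4) by (auto simp: disjnt_def)
    have im: "Some ` U = Some ` (U \<union> K) - Some ` K"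
      using that(4) by (auto simp: disjnt_def)
    have sub: "Some ` K \<subseteq> Some ` (U \<union> K)" by auto
    consider "openin X (U \<union> K)" | "compactin X (U \<union> K)" using UK unfolding open_or_compact_in_def by blast
    then show ?thesis
    proof cases
      case 1
      then have "openin (Alexandroff_compactification X) (Some ` (U \<union> K))" by simp
      from inner_Diff_closed[OF closedin_image_Some[OF K] this sub]
      show ?thesis unfolding im[symmetric] using 1 U K by (simp add: extension_open extension_compact)
    next
      case 2
      have "openin (Alexandroff_compactification X) (Some ` (U \<union> K) - Some ` K)" unfolding im[symmetric] using U by simp
      from outer_Diff_closed[OF closedin_image_Some[OF K] closedin_image_Some[OF 2] sub this]
      show ?thesis unfolding im[symmetric] using 2 U K by (simp add: extension_open extension_compact)
    qed
  qed
  consider "openin X A" "openin X B" | "openin X A" "compactin X B" | "compactin X A" "openin X B"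
    | "compactin X A" "compactin X B"
    using A B unfolding open_or_compact_in_def by blast
  then show ?thesis
  proof cases
    case 1
    have "Some ` A \<inter> Some ` B = {}" using disj by (auto simp: disjnt_def)
    then have "inner (Some ` A \<union> Some ` B) = inner (Some ` A) + inner (Some ` B)"
      using 1 by (intro inner_Un_open) simp_all
    then show ?thesis using 1 by (simp add: extension_open openin_Un image_Un)
  next
    case 2
    then show ?thesis using mixed AB disj by blast
  next
    case 3
    have "extension (B \<union> A) = extension B + extension A"
      by (rule mixed[OF 3(2,1)]) (use AB disj in \<open>simp_all add: Un_commute disjnt_sym\<close>)
    then show ?thesis by (simp add: Un_commute add.commute)
  next
    case 4
    have "disjnt (Some ` A) (Some ` B)" using disj by (auto simp: disjnt_def)
    then have "outer (Some ` A \<union> Some ` B) = outer (Some ` A) + outer (Some ` B)"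
      using 4 by (intro outer_Un_closed closedin_image_Some)
    then show ?thesis using 4 by (simp add: extension_compact compactin_Un image_Un)
  qed
qed

lemma family_base:
  assumes "closed_family \<N>" "\<Union>\<N> \<subseteq> Some ` U"
  obtains K where "compactin X K" "K \<subseteq> U" "\<Union>\<N> = Some ` K"
proof -
  obtain K where K: "K \<subseteq> U" "\<Union>\<N> = Some ` K" using assms(2) by (auto simp: subset_image_iff)
  have "closedin (Alexandroff_compactification X) (Some ` K)" using closed_family_closedin[OF assms(1)] K by simp
  then have "compactin X K" by simp
  then show ?thesis using that K by blast
qed

lemma topological_measure_extension: "topological_measure X (\<lambda>A. ereal (extension A))"
  unfolding topological_measure_def
proof (intro conjI allI impI)
  show "0 \<le> ereal (extension A)" if "open_or_closed_in X A" for A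
    using that extension_nonneg[of A] openin_subset[of X A] closedin_subset[of X A]
    unfolding open_or_closed_in_def by auto
  show "\<exists>A. open_or_closed_in X A \<and> ereal (extension A) \<noteq> \<infinity>"
    by (intro exI[of _ "{}"]) (simp add: open_or_closed_in_def)
  show "ereal (extension (A \<union> B)) = ereal (extension A) + ereal (extension B)"
    if "open_or_compact_in X A \<and> open_or_compact_in X B \<and> open_or_compact_in X (A \<union> B) \<and> disjnt A B" for A B
    using that by (simp add: extension_additive)
  show "ereal (extension U) = (SUP K\<in>{K. compactin X K \<and> K \<subseteq> U}. ereal (extension K))"
    if U: "openin X U" for U
  proof (rule antisym)
    show "(SUP K\<in>{K. compactin X K \<and> K \<subseteq> U}. ereal (extension K)) \<le> ereal (extension U)"
      using U by (intro SUP_least) (simp add: extension_lower extension_open)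
    show "ereal (extension U) \<le> (SUP K\<in>{K. compactin X K \<and> K \<subseteq> U}. ereal (extension K))"
    proof (rule ereal_le_epsilon2)
      fix e :: real assume "0 < e"
        obtain \<N> where N: "closed_family \<N>" "\<Union>\<N> \<subseteq> Some ` U" "inner (Some ` U) < sum mass \<N> + e"
          using inner_approx[OF \<open>0 < e\<close>] by metis
        obtain K where K: "compactin X K" "K \<subseteq> U" "\<Union>\<N> = Some ` K" by (rule family_base[OF N(1,2)])
        have "extension U \<le> extension K + e"
          using N(3) U K outer_family[OF N(1)] by (simp add: extension_open extension_compact)
        then have "ereal (extension U) \<le> ereal (extension K) + ereal e" by simp
        also have "\<dots> \<le> (SUP K\<in>{K. compactin X K \<and> K \<subseteq> U}. ereal (extension K)) + ereal e"
          using K by (intro add_right_mono SUP_upper) simp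
        finally show "ereal (extension U) \<le> (SUP K\<in>{K. compactin X K \<and> K \<subseteq> U}. ereal (extension K)) + ereal e" .
    qed
  qed
  show "ereal (extension F) = (INF U\<in>{U. openin X U \<and> F \<subseteq> U}. ereal (extension U))"
    if F: "closedin X F" for F
  proof (rule antisym)
    show "ereal (extension F) \<le> (INF U\<in>{U. openin X U \<and> F \<subseteq> U}. ereal (extension U))"
      by (intro INF_greatest) (simp add: extension_lower extension_open)
    show "(INF U\<in>{U. openin X U \<and> F \<subseteq> U}. ereal (extension U)) \<le> ereal (extension F)"
    proof (rule ereal_le_epsilon2)
      fix e :: real assume "0 < e"
        obtain V where V: "openin X V" "F \<subseteq> V" "inner (Some ` V) < extension F + e"
          using extension_approx[OF closedin_subset[OF F] \<open>0 < e\<close>] by auto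
        have "(INF U\<in>{U. openin X U \<and> F \<subseteq> U}. ereal (extension U)) \<le> ereal (extension V)"
          using V by (intro INF_lower) simp
        also have "\<dots> \<le> ereal (extension F) + ereal e" using V by (simp add: extension_open)
        finally show "(INF U\<in>{U. openin X U \<and> F \<subseteq> U}. ereal (extension U)) \<le> ereal (extension F) + ereal e" .
    qed
  qed
qed

end

section \<open>The weight of a variation\<close>

lemma Alexandroff_trace_cases:
  assumes X: "Hausdorff_space X" and A: "open_or_closed_in (Alexandroff_compactification X) A"
  shows "(None \<notin> A \<and> open_or_compact_in X (Some -` A)) \<or>
    (None \<in> A \<and> open_or_compact_in X (topspace X - Some -` A) \<and> Some -` A \<subseteq> topspace X)"
proof -
  have "(\<exists>U. openin X U \<and> A = Some ` U) \<or> (\<exists>C. compactin X C \<and> A = insert None (Some ` (topspace X - C))) \<or>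
      (\<exists>K. compactin X K \<and> A = Some ` K) \<or> (\<exists>U. openin X U \<and> A = insert None (Some ` topspace X) - Some ` U)"
    using A unfolding open_or_closed_in_def openin_Alexandroff_compactification
      closedin_Alexandroff_compactification topspace_Alexandroff_compactification
    by metis
  then consider (a) U where "openin X U" "A = Some ` U"
    | (b) C where "compactin X C" "A = insert None (Some ` (topspace X - C))"
    | (c) K where "compactin X K" "A = Some ` K"
    | (d) U where "openin X U" "A = insert None (Some ` topspace X) - Some ` U"
    by metis
  then show ?thesis
  proof cases
    case a
    then have "Some -` A = U" by auto
    then show ?thesis using a unfolding open_or_compact_in_def by auto
  next
    case b
    then have "Some -` A = topspace X - C" by auto
    moreover have "topspace X - (topspace X - C) = C" using compactin_subset_topspace[OF b(1)] by auto
    ultimately show ?thesis using b unfolding open_or_compact_in_def by simp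
  next
    case c
    then have "Some -` A = K" by auto
    then show ?thesis using c unfolding open_or_compact_in_def by auto
  next
    case d
    then have "Some -` A = topspace X - U" by auto
    moreover have "topspace X - (topspace X - U) = U" using openin_subset[OF d(1)] by auto
    ultimately show ?thesis using d unfolding open_or_compact_in_def by auto
  qed
qed

text \<open>
  The variation itself is not additive for a set and its complement. The point at infinity breaks the
  tie: the variation is kept on sets that avoid this point, and its complementary value is used on
  sets that contain it.
\<close>

definition compactification_weight :: "'a topology \<Rightarrow> ('a set \<Rightarrow> real) \<Rightarrow> 'a option set \<Rightarrow> real" where
  "compactification_weight X r A =
     (if None \<in> A then outer_variation X r (topspace X) - outer_variation X r (topspace X - Some -` A)
      else outer_variation X r (Some -` A))"

locale compactified_signed_measure = finite_signed_topological_measure X r + genus_zero_space "Alexandroff_compactification X"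
  for X :: "'a topology" and r
begin

abbreviation "Y \<equiv> Alexandroff_compactification X"
abbreviation "weight \<equiv> compactification_weight X r"

lemma weight_without: "None \<notin> A \<Longrightarrow> weight A = pos (Some -` A)"
  and weight_with: "None \<in> A \<Longrightarrow> weight A = pos (topspace X) - pos (topspace X - Some -` A)"
  unfolding compactification_weight_def by simp_all

lemmas trace_cases = Alexandroff_trace_cases[OF Hausdorff_X]

lemma open_or_compact_in_subset: "open_or_compact_in X A \<Longrightarrow> A \<subseteq> topspace X"
  unfolding open_or_compact_in_def by (metis openin_subset compactin_subset_topspace)

lemma weight_topspace: "weight (topspace Y) = pos (topspace X)"
proof -
  have "Some -` topspace Y = topspace X" by auto
  then show ?thesis by (simp add: weight_with pos_empty)
qed

text \<open>
  If \<open>B\<close> contains infinity, the trace of its complement is added to the family in \<open>X\<close>; if a member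
  \<open>A0\<close> contains infinity, the trace of its complement takes over the role of the large set. In each
  case the claim becomes superadditivity of the variation in \<open>X\<close>.
\<close>

lemma weight_superadditive:
  assumes fin: "finite \<A>" and disj: "pairwise disjnt \<A>"
    and oc: "\<And>A. A \<in> \<A> \<Longrightarrow> open_or_closed_in Y A" and B: "open_or_closed_in Y B" "\<Union>\<A> \<subseteq> B"
  shows "sum weight \<A> \<le> weight B"
proof -
  let ?S = "topspace X"
  \<comment> \<open>away from infinity the weight is \<open>pos\<close> of the trace on \<open>X\<close>, so such families can be moved to \<open>X\<close>\<close>
  have base: "sum pos ((\<lambda>A. Some -` A) ` \<B>) = sum weight \<B> \<and> pairwise disjnt ((\<lambda>A. Some -` A) ` \<B>) \<and>
      (\<forall>D\<in>(\<lambda>A. Some -` A) ` \<B>. open_or_compact_in X D)"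
    if \<B>: "\<B> \<subseteq> \<A>" and None': "\<forall>A\<in>\<B>. None \<notin> A" for \<B>
  proof (intro conjI)
    note None = None'[rule_format]
    have inj: "inj_on (\<lambda>A. Some -` A) \<B>"
    proof (rule inj_onI)
      fix A A' :: "'a option set" assume "A \<in> \<B>" "A' \<in> \<B>" "Some -` A = Some -` A'"
      then have "x \<in> A \<longleftrightarrow> x \<in> A'" for x using None[of A] None[of A'] by (cases x) auto
      then show "A = A'" by auto
    qed
    show "sum pos ((\<lambda>A. Some -` A) ` \<B>) = sum weight \<B>"
      using None by (simp add: sum.reindex[OF inj] weight_without)
    show "pairwise disjnt ((\<lambda>A. Some -` A) ` \<B>)"
    proof (rule pairwiseI)
      fix D D' assume "D \<in> (\<lambda>A. Some -` A) ` \<B>" "D' \<in> (\<lambda>A. Some -` A) ` \<B>" "D \<noteq> D'"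
      then obtain A A' where A: "A \<in> \<A>" "A' \<in> \<A>" "A \<noteq> A'" "D = Some -` A" "D' = Some -` A'" using \<B> by auto
      then have "disjnt A A'" using pairwiseD[OF disj A(1-3)] by simp
      then show "disjnt D D'" using A(4,5) by (auto simp: disjnt_def)
    qed
    show "\<forall>D\<in>(\<lambda>A. Some -` A) ` \<B>. open_or_compact_in X D"
      using trace_cases oc \<B> None by blast
  qed
  show ?thesis
  proof (cases "None \<in> B")
    case False
    then have None: "\<forall>A\<in>\<A>. None \<notin> A" using B(2) by blast
    note b = base[OF subset_refl None, THEN conjunct1]
      and bd = base[OF subset_refl None, THEN conjunct2, THEN conjunct1]
      and bo = base[OF subset_refl None, THEN conjunct2, THEN conjunct2, THEN bspec]
    have dB: "Some -` B \<subseteq> ?S" using trace_cases[OF B(1)] open_or_compact_in_subset by auto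
    have "sum pos ((\<lambda>A. Some -` A) ` \<A>) \<le> pos (Some -` B)"
      by (rule pos_superadditive) (use bd bo fin dB B(2) in auto)
    then show ?thesis using b weight_without[OF False] by simp
  next
    case True
    let ?C = "?S - Some -` B"
    have C: "open_or_compact_in X ?C" using trace_cases[OF B(1)] True by simp
    \<comment> \<open>in a set of sets, \<open>?C\<close> may coincide with a member; it is then empty and has variation zero\<close>
    have insertC: "sum pos (insert ?C \<D>) = pos ?C + sum pos \<D>"
      if "finite \<D>" "\<And>D. D \<in> \<D> \<Longrightarrow> D \<subseteq> Some -` B" for \<D>
    proof (cases "?C \<in> \<D>")
      case True
      then have "?C = {}" using that(2)[of ?C] by blast
      then have "pos ?C = 0" by (metis pos_empty)
      then show ?thesis using True by (simp add: insert_absorb)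
    qed (use that(1) in simp)
    have disjC: "pairwise disjnt (insert ?C \<D>)"
      if "pairwise disjnt \<D>" "\<And>D. D \<in> \<D> \<Longrightarrow> D \<subseteq> Some -` B" for \<D>
      unfolding pairwise_insert
    proof (intro conjI allI impI that(1))
      fix D assume "D \<in> \<D> \<and> D \<noteq> ?C"
      then have "D \<subseteq> Some -` B" using that(2)[of D] by simp
      then show "disjnt ?C D" "disjnt D ?C" unfolding disjnt_def by auto
    qed
    show ?thesis
    proof (cases "None \<in> \<Union>\<A>")
      case False
      then have None: "\<forall>A\<in>\<A>. None \<notin> A" by blast
      note b = base[OF subset_refl None, THEN conjunct1]
      and bd = base[OF subset_refl None, THEN conjunct2, THEN conjunct1]
      and bo = base[OF subset_refl None, THEN conjunct2, THEN conjunct2, THEN bspec]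
      let ?\<D> = "(\<lambda>A. Some -` A) ` \<A>"
      have in_B: "D \<subseteq> Some -` B" if "D \<in> ?\<D>" for D using that B(2) by auto
      have "sum pos (insert ?C ?\<D>) \<le> pos ?S"
      proof (rule pos_superadditive)
        show "pairwise disjnt (insert ?C ?\<D>)"
          by (rule disjC[OF bd in_B])
        have "D \<subseteq> ?S" if "D \<in> ?\<D>" for D using open_or_compact_in_subset[OF bo] that by blast
        then show "\<Union>(insert ?C ?\<D>) \<subseteq> ?S" by auto
      qed (use fin C bo in \<open>auto simp del: vimage_eq\<close>)
      then have "pos ?C + sum weight \<A> \<le> pos ?S" using insertC[of ?\<D>] fin in_B b by simp
      then show ?thesis using weight_with[OF True] by simp
    next
      case True': True
      then obtain A0 where A0: "A0 \<in> \<A>" "None \<in> A0" by blast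
      let ?\<B> = "\<A> - {A0}"
      have None: "\<forall>A\<in>?\<B>. None \<notin> A"
      proof
        fix A assume "A \<in> ?\<B>"
        then show "None \<notin> A" using pairwiseD[OF disj, of A A0] A0 by (auto simp: disjnt_def)
      qed
      note b = base[OF Diff_subset[of _ "{A0}"] None, THEN conjunct1]
      and bd = base[OF Diff_subset[of _ "{A0}"] None, THEN conjunct2, THEN conjunct1]
      and bo = base[OF Diff_subset[of _ "{A0}"] None, THEN conjunct2, THEN conjunct2, THEN bspec]
      let ?\<D> = "(\<lambda>A. Some -` A) ` ?\<B>"
      let ?R = "?S - Some -` A0"
      have in_B: "D \<subseteq> Some -` B" if "D \<in> ?\<D>" for D using that B(2) by auto
      have in_R: "D \<subseteq> ?R" if D: "D \<in> ?\<D>" for D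
      proof -
        obtain A where A: "A \<in> ?\<B>" "D = Some -` A" using D by (rule imageE)
        have "disjnt A A0" using pairwiseD[OF disj, of A A0] A A0 by auto
        moreover have "D \<subseteq> ?S" using open_or_compact_in_subset[OF bo[OF D]] .
        ultimately show ?thesis using A(2) by (auto simp: disjnt_def)
      qed
      have "sum pos (insert ?C ?\<D>) \<le> pos ?R"
      proof (rule pos_superadditive)
        show "pairwise disjnt (insert ?C ?\<D>)"
          by (rule disjC[OF bd in_B])
        have "?C \<subseteq> ?R" using A0 B(2) by auto
        then show "\<Union>(insert ?C ?\<D>) \<subseteq> ?R" using in_R by auto
      qed (use fin C bo in \<open>auto simp del: vimage_eq\<close>)
      then have "pos ?C + sum weight ?\<B> \<le> pos ?R" using insertC[of ?\<D>] fin in_B b by simp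
      moreover have "sum weight \<A> = weight A0 + sum weight ?\<B>" using fin A0(1) by (rule sum.remove)
      ultimately show ?thesis using weight_with[OF True] weight_with[OF A0(2)] by simp
    qed
  qed
qed

text \<open>
  Away from infinity this is outer regularity of the variation. For a set that contains infinity it
  is inner regularity on the open complement: a compact set \<open>K\<close> there that almost realises the
  variation is removed from \<open>V\<close>.
\<close>

lemma weight_outer_regular:
  assumes H: "closedin Y H" and V: "openin Y V" "H \<subseteq> V" and e: "0 < e"
  shows "\<exists>V'. openin Y V' \<and> H \<subseteq> V' \<and> V' \<subseteq> V \<and> weight V' < weight H + e"
proof (cases "None \<in> H")
  case False
  then obtain K where K: "compactin X K" "H = Some ` K"
    using H by (auto simp: closedin_Alexandroff_compactification)
  have dH: "Some -` H = K" using K(2) by auto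
  obtain W where W: "openin X W" "K \<subseteq> W" "var W < pos K + e"
    using pos_approx[OF compactin_subset_topspace[OF K(1)] e] by blast
  define V0 where "V0 = {x \<in> topspace X. Some x \<in> V}"
  have V0: "openin X V0" unfolding V0_def
    using continuous_map_Some[of X] V(1) unfolding continuous_map_def by simp
  have KV0: "K \<subseteq> V0" using V(2) K compactin_subset_topspace[OF K(1)] unfolding V0_def by auto
  let ?O = "W \<inter> V0"
  have O: "openin X ?O" using W V0 by auto
  have "Some -` (Some ` ?O) = ?O" by auto
  then have "weight (Some ` ?O) = var ?O" using O by (simp add: weight_without pos_open)
  also have "\<dots> \<le> var W" by (rule var_mono) auto
  also have "\<dots> < weight H + e" using W(3) weight_without[OF False] dH by simp
  finally have "weight (Some ` ?O) < weight H + e" .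
  moreover have "openin Y (Some ` ?O)" using O by simp
  moreover have "H \<subseteq> Some ` ?O" using W(2) KV0 K(2) by auto
  moreover have "Some ` ?O \<subseteq> V" by (auto simp: V0_def)
  ultimately show ?thesis by blast
next
  case True
  then obtain U where U: "openin X U" "H = topspace Y - Some ` U"
    using H by (auto simp: closedin_Alexandroff_compactification)
  have US: "U \<subseteq> topspace X" using U(1) by (rule openin_subset)
  have dH: "topspace X - Some -` H = U" using US U(2) by auto
  obtain K where K: "compactin X K" "K \<subseteq> U" "var U < r K + e" using var_approx[OF e] by blast
  have KS: "K \<subseteq> topspace X" using K US by blast
  let ?V = "V - Some ` K"
  have "closedin Y (Some ` K)" using K(1) Hausdorff_X by (simp add: compactin_imp_closedin)
  then have op: "openin Y ?V" using V(1) by (rule openin_diff[rotated])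
  have HV: "H \<subseteq> ?V" using V(2) U(2) K(2) by auto
  have "K \<subseteq> topspace X - Some -` ?V" using KS by auto
  then have "pos K \<le> pos (topspace X - Some -` ?V)" by (rule pos_mono) auto
  then have "r K \<le> pos (topspace X - Some -` ?V)" using compact_le_pos[OF K(1)] by simp
  moreover have "None \<in> ?V" using HV True by blast
  ultimately have "weight ?V < weight H + e"
    using K(3) weight_with[OF True] weight_with[of ?V] dH U(1) by (simp add: pos_open)
  then show ?thesis using op HV by blast
qed

lemma complementary_weight: "complementary_weight Y weight"
proof (unfold_locales)
  fix A assume A: "open_or_closed_in Y A"
  note c = trace_cases[OF A]
  show "0 \<le> weight A"
    using c pos_nonneg[OF open_or_compact_in_subset] pos_mono[of "topspace X - Some -` A" "topspace X"]
    by (cases "None \<in> A") (auto simp: weight_with weight_without)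
  have d: "Some -` (topspace Y - A) = topspace X - Some -` A" by auto
  show "weight A + weight (topspace Y - A) = weight (topspace Y)"
  proof (cases "None \<in> A")
    case True
    then show ?thesis
      unfolding weight_topspace using weight_with[OF True] weight_without[of "topspace Y - A"] d by simp
  next
    case False
    then have "topspace X - (topspace X - Some -` A) = Some -` A" using c open_or_compact_in_subset by blast
    then show ?thesis
      unfolding weight_topspace using weight_without[OF False] weight_with[of "topspace Y - A"] d False by simp
  qed
next
  fix \<A> B
  assume "finite \<A>" "pairwise disjnt \<A>" "\<And>A. A \<in> \<A> \<Longrightarrow> open_or_closed_in Y A"
    "open_or_closed_in Y B" "\<Union>\<A> \<subseteq> B"
  then show "sum weight \<A> \<le> weight B" by (rule weight_superadditive)
next
  fix H V and e :: real
  assume "closedin Y H" "openin Y V" "H \<subseteq> V" "0 < e"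
  then show "\<exists>V'. openin Y V' \<and> H \<subseteq> V' \<and> V' \<subseteq> V \<and> weight V' < weight H + e"
    by (rule weight_outer_regular)
qed

sublocale compactified_weight X weight
  by (rule compactified_weight.intro[OF complementary_weight])

end

section \<open>The difference of the two measures\<close>

text \<open>
  The prefixes \<open>P\<close> and \<open>N\<close> mark the constructions from the positive and from the negative variation.
\<close>

locale signed_pair = P: compactified_signed_measure X r + N: compactified_signed_measure X "\<lambda>A. - r A"
  for X :: "'a topology" and r :: "'a set \<Rightarrow> real"
begin

lemma weight_difference:
  assumes A: "open_or_closed_in P.Y A"
  shows "P.weight A - N.weight A =
    (if None \<in> A then r (topspace X) - r (topspace X - Some -` A) else r (Some -` A))"
proof (cases "None \<in> A")
  case True
  then have "open_or_compact_in X (topspace X - Some -` A)" using P.trace_cases[OF A] by simp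
  from P.pos_minus_neg[OF this] P.pos_minus_neg[of "topspace X"]
  show ?thesis using True P.weight_with[OF True] N.weight_with[OF True]
    by (simp add: open_or_compact_in_def)
next
  case False
  then have "open_or_compact_in X (Some -` A)" using P.trace_cases[OF A] by simp
  from P.pos_minus_neg[OF this] show ?thesis
    using False P.weight_without[OF False] N.weight_without[OF False] by simp
qed

text \<open>
  Let \<open>V\<close> be the component of the complement of \<open>C\<close> that contains infinity. The difference of the two
  masses is \<open>r (X - V)\<close> minus the sum of the values of \<open>r\<close> on the other components. By countable
  additivity that sum is the value of \<open>r\<close> on their union \<open>(X - V) - C\<close>.
\<close>

lemma mass_difference:
  assumes C: "closedin P.Y C" "connectedin P.Y C" "C \<noteq> {}" and None: "None \<notin> C"
  shows "P.mass C - N.mass C = r (Some -` C)"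
proof -
  let ?S = "topspace P.Y" and ?d = "\<lambda>A. Some -` A :: 'a set"
  let ?\<U> = "comps P.Y (?S - C)"
  let ?w = "\<lambda>U. P.weight U - N.weight U"
  have CS: "C \<subseteq> ?S" by (rule closedin_subset[OF C(1)])
  have "{None} \<subseteq> ?S - C" using None by simp
  then obtain V where V: "V \<in> ?\<U>" "{None} \<subseteq> V"
    by (rule comps_superset[of P.Y "{None}", rotated 2]) simp_all
  let ?\<B> = "?\<U> - {V}"
  have None': "None \<notin> U" if "U \<in> ?\<B>" for U
  proof -
    have "U \<inter> V = {}" using connected_components_of_overlap[of U _ V] that V(1) by auto
    then show ?thesis using V(2) by auto
  qed
  have op: "openin P.Y U" if "U \<in> ?\<U>" for U by (rule P.complement_comp_solid(1)[OF C that])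
  have oc: "open_or_closed_in P.Y U" if "U \<in> ?\<U>" for U
    using op[OF that] by (simp add: open_or_closed_in_def)
  have opd: "openin X (?d U)" if U: "U \<in> ?\<B>" for U
  proof -
    have "U = Some ` ?d U"
    proof (rule set_eqI)
      show "x \<in> U \<longleftrightarrow> x \<in> Some ` ?d U" for x using None'[OF U] by (cases x) auto
    qed
    moreover have "openin P.Y U" using op U by simp
    ultimately show ?thesis by (metis openin_Alexandroff_compactification_image_Some)
  qed
  have disj: "disjoint_family_on ?d ?\<B>"
    unfolding disjoint_family_on_def
  proof (intro ballI impI)
    fix U U' assume "U \<in> ?\<B>" "U' \<in> ?\<B>" "U \<noteq> U'"
    then have "U \<inter> U' = {}" using connected_components_of_overlap[of U _ U'] by auto
    then show "?d U \<inter> ?d U' = {}" by auto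
  qed
  let ?O = "\<Union>U\<in>?\<B>. ?d U"
  have "((\<lambda>U. r (?d U)) has_sum r ?O) ?\<B>"
    by (rule P.r_has_sum_disjoint_open[OF opd disj])
  moreover have "?w U = r (?d U)" if "U \<in> ?\<B>" for U
    using weight_difference[OF oc[of U]] None'[OF that] that by simp
  ultimately have "(?w has_sum r ?O) ?\<B>" by (subst has_sum_cong)
  then have sum1: "(?w has_sum (?w V + r ?O)) ?\<U>"
    using has_sum_insert[of V ?\<B> ?w "r ?O"] V(1) by (simp add: insert_absorb)
  have "((\<lambda>U. P.weight U + - N.weight U) has_sum (P.weight ?S - P.mass C + - (N.weight ?S - N.mass C))) ?\<U>"
    by (intro has_sum_add has_sum_uminusI P.lam_has_sum_mass N.lam_has_sum_mass C)
  then have "(?w has_sum (P.weight ?S - N.weight ?S - (P.mass C - N.mass C))) ?\<U>"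
    by (simp add: algebra_simps)
  from has_sum_unique[OF this sum1]
  have eq: "P.weight ?S - N.weight ?S - (P.mass C - N.mass C) = ?w V + r ?O" .
  have ocS: "open_or_closed_in P.Y ?S" unfolding open_or_closed_in_def by (rule disjI1[OF openin_topspace])
  have "?d ?S = topspace X" by auto
  then have total: "P.weight ?S - N.weight ?S = r (topspace X)"
    using weight_difference[OF ocS] P.r_empty by simp
  let ?H = "topspace X - ?d V"
  have wV: "?w V = r (topspace X) - r ?H" using weight_difference[OF oc[OF V(1)]] V(2) by simp
  have cptC: "compactin X (?d C)"
  proof -
    have "C = Some ` ?d C"
    proof (rule set_eqI)
      show "x \<in> C \<longleftrightarrow> x \<in> Some ` ?d C" for x using None by (cases x) auto
    qed
    then show ?thesis using C(1) by (metis closedin_Alexandroff_compactification_image_Some)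
  qed
  have cptH: "compactin X ?H"
  proof -
    have "?S - V = Some ` ?H" using V(2) by auto
    moreover have "closedin P.Y (?S - V)" by (rule P.complement_comp_solid(2)[OF C V(1)])
    ultimately show ?thesis by (metis closedin_Alexandroff_compactification_image_Some)
  qed
  have un: "\<Union>?\<U> = ?S - C" by (rule Union_comps) blast
  have H: "?H = ?d C \<union> ?O"
  proof (intro equalityI subsetI)
    fix x assume x: "x \<in> ?H"
    show "x \<in> ?d C \<union> ?O"
    proof (cases "Some x \<in> C")
      case False
      then have "Some x \<in> \<Union>?\<U>" unfolding un using x by simp
      then show ?thesis using x by auto
    qed simp
  next
    fix x assume "x \<in> ?d C \<union> ?O"
    then consider "Some x \<in> C" | U where "U \<in> ?\<B>" "Some x \<in> U" by auto
    then show "x \<in> ?H"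
    proof cases
      case 1
      then show ?thesis using CS compsD(3)[OF V(1)] by auto
    next
      case 2
      then have "U \<inter> V = {}" using connected_components_of_overlap[of U _ V] V(1) by auto
      moreover have "U \<subseteq> ?S" using compsD(4)[of U] 2 by blast
      ultimately show ?thesis using 2 by auto
    qed
  qed
  have "disjnt (?d C) ?O"
  proof -
    have "U \<inter> C = {}" if "U \<in> ?\<B>" for U using compsD(3)[of U P.Y "?S - C"] that by blast
    then show ?thesis by (auto simp: disjnt_def)
  qed
  moreover have "openin X ?O" using opd by auto
  moreover have "compactin X (?d C \<union> ?O)" using cptH unfolding H .
  ultimately have "r (?d C \<union> ?O) = r (?d C) + r ?O"
    using cptC by (intro P.additive) (simp_all add: open_or_compact_in_def)
  then have "r ?H = r (?d C) + r ?O" unfolding H .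
  then show ?thesis using eq total wV by simp
qed

lemma family_difference:
  assumes \<N>: "P.closed_family \<N>" and sub: "\<Union>\<N> \<subseteq> Some ` U"
  shows "sum P.mass \<N> - sum N.mass \<N> = r (Some -` \<Union>\<N>)"
proof -
  let ?d = "\<lambda>A. Some -` A :: 'a set"
  have fin: "finite \<N>" and cl: "\<And>C. C \<in> \<N> \<Longrightarrow> closedin P.Y C \<and> connectedin P.Y C \<and> C \<noteq> {}"
    and dj: "pairwise disjnt \<N>"
    using \<N> unfolding P.closed_family_def by simp_all
  have None: "None \<notin> C" if "C \<in> \<N>" for C using sub that by auto
  have "sum P.mass \<N> - sum N.mass \<N> = (\<Sum>C\<in>\<N>. P.mass C - N.mass C)" by (simp add: sum_subtractf)
  also have "\<dots> = (\<Sum>C\<in>\<N>. r (?d C))"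
    using mass_difference cl None by (intro sum.cong) auto
  also have "\<dots> = r (\<Union>C\<in>\<N>. ?d C)"
  proof (rule P.r_UN_compact[symmetric, OF fin])
    fix C assume C: "C \<in> \<N>"
    have "C = Some ` ?d C"
    proof (rule set_eqI)
      show "x \<in> C \<longleftrightarrow> x \<in> Some ` ?d C" for x using None[OF C] by (cases x) auto
    qed
    then show "compactin X (?d C)" using cl[OF C] by (metis closedin_Alexandroff_compactification_image_Some)
  next
    show "disjoint_family_on ?d \<N>"
      unfolding disjoint_family_on_def
    proof (intro ballI impI)
      fix C D assume "C \<in> \<N>" "D \<in> \<N>" "C \<noteq> D"
      then have "disjnt C D" using pairwiseD[OF dj, of C D] by simp
      then show "?d C \<inter> ?d D = {}" by (auto simp: disjnt_def)
    qed
  qed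
  also have "(\<Union>C\<in>\<N>. ?d C) = ?d (\<Union>\<N>)" by auto
  finally show ?thesis .
qed

text \<open>
  Finite disjoint families of closed connected sets are cofinal among the compact subsets of \<open>U\<close>. So
  one family can be close to the supremum for both inner measures and also contain a prescribed
  compact set, beyond which \<open>r\<close> is close to \<open>r U\<close>.
\<close>

lemma open_difference:
  assumes U: "openin X U"
  shows "r U = P.inner (Some ` U) - N.inner (Some ` U)"
proof -
  have close: "\<bar>r U - (P.inner (Some ` U) - N.inner (Some ` U))\<bar> \<le> 2 * e" if e: "0 < e" for e
  proof -
    obtain K where K: "compactin X K" "K \<subseteq> U"
      "\<forall>L. compactin X L \<and> K \<subseteq> L \<and> L \<subseteq> U \<longrightarrow> \<bar>r L - r U\<bar> < e"
      using P.inner_limit[OF U e] by auto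
    obtain \<M> where M: "P.closed_family \<M>" "\<Union>\<M> \<subseteq> Some ` U" "P.inner (Some ` U) < sum P.mass \<M> + e"
      using P.inner_approx[OF e] by metis
    obtain \<M>' where M': "P.closed_family \<M>'" "\<Union>\<M>' \<subseteq> Some ` U" "N.inner (Some ` U) < sum N.mass \<M>' + e"
      using N.inner_approx[OF e] by metis
    let ?C = "Some ` K \<union> (\<Union>\<M> \<union> \<Union>\<M>')"
    have "closedin P.Y ?C"
      by (intro closedin_Un P.closed_family_closedin M(1) M'(1) P.closedin_image_Some K(1))
    moreover have "openin P.Y (Some ` U)" using U by simp
    moreover have "?C \<subseteq> Some ` U" using K(2) M(2) M'(2) by auto
    ultimately obtain \<N> where N: "P.closed_family \<N>" "?C \<subseteq> \<Union>\<N>" "\<Union>\<N> \<subseteq> Some ` U"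
      by (rule P.finite_closed_connected_cover)
    obtain L where L: "compactin X L" "L \<subseteq> U" "\<Union>\<N> = Some ` L" by (rule P.family_base[OF N(1,3)])
    have dL: "Some -` \<Union>\<N> = L" unfolding L(3) by auto
    have "Some ` K \<subseteq> Some ` L" using N(2) unfolding L(3) by simp
    then have "K \<subseteq> L" by auto
    then have "\<bar>r L - r U\<bar> < e" using K(3) L by simp
    moreover have "sum P.mass \<N> - sum N.mass \<N> = r L"
      using family_difference[OF N(1,3)] unfolding dL .
    moreover have "sum P.mass \<M> \<le> sum P.mass \<N>"
      using P.inner_upper[OF M(1), of "\<Union>\<N>"] P.inner_family_le[OF N(1)] N(2) by simp
    moreover have "sum N.mass \<M>' \<le> sum N.mass \<N>"
      using N.inner_upper[OF M'(1), of "\<Union>\<N>"] N.inner_family_le[OF N(1)] N(2) by simp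
    moreover have "sum P.mass \<N> \<le> P.inner (Some ` U)" by (rule P.inner_upper[OF N(1,3)])
    moreover have "sum N.mass \<N> \<le> N.inner (Some ` U)" by (rule N.inner_upper[OF N(1,3)])
    ultimately show ?thesis using M(3) M'(3) unfolding abs_le_iff abs_less_iff by linarith
  qed
  have "\<bar>r U - (P.inner (Some ` U) - N.inner (Some ` U))\<bar> \<le> 0 + e" if "0 < e" for e
    using close[of "e/2"] that by simp
  then have "\<bar>r U - (P.inner (Some ` U) - N.inner (Some ` U))\<bar> \<le> 0" by (rule field_le_epsilon)
  then show ?thesis by simp
qed

lemma extension_difference:
  assumes A: "open_or_closed_in X A"
  shows "r A = P.extension A - N.extension A"
proof (cases "openin X A")
  case True
  then show ?thesis using open_difference by (simp add: P.extension_open N.extension_open)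
next
  case False
  then have C: "closedin X A" using A unfolding open_or_closed_in_def by simp
  note AS = closedin_subset[OF C]
  show ?thesis
  proof (rule P.difference_on_closed[of "\<lambda>V. P.inner (Some ` V)" "\<lambda>V. N.inner (Some ` V)"])
    show "r U = P.inner (Some ` U) - N.inner (Some ` U)" if "openin X U" for U
      by (rule open_difference[OF that])
    show "P.inner (Some ` U) \<le> P.inner (Some ` V)" "N.inner (Some ` U) \<le> N.inner (Some ` V)"
      if "U \<subseteq> V" for U V
      using that by (auto intro: P.inner_mono N.inner_mono)
  qed (use C AS P.extension_lower N.extension_lower P.extension_approx N.extension_approx in auto)
qed

end

text \<open>
  All values are limits of values on compact sets, directly for open sets and through open sets for
  closed ones, so the norm bounds them all.
\<close>

lemma signed_topological_measure_finite:
  assumes H: "Hausdorff_space X" and \<nu>: "signed_topological_measure X \<nu>"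
    and norm: "signed_topological_measure_norm X \<nu> < \<infinity>"
  shows "finite_signed_topological_measure X (\<lambda>A. real_of_ereal (\<nu> A))"
    and "\<And>A. open_or_closed_in X A \<Longrightarrow> \<nu> A = ereal (real_of_ereal (\<nu> A))"
proof -
  let ?r = "\<lambda>A. real_of_ereal (\<nu> A)"
  have add: "\<nu> (A \<union> B) = \<nu> A + \<nu> B"
    if "open_or_compact_in X A" "open_or_compact_in X B" "open_or_compact_in X (A \<union> B)" "disjnt A B" for A B
    using \<nu> that unfolding signed_topological_measure_def by simp
  have inner: "(\<nu> \<longlongrightarrow> \<nu> U) (compact_subsets_at_top X U)" if "openin X U" for U
    using \<nu> that unfolding signed_topological_measure_def by simp
  have outer: "(\<nu> \<longlongrightarrow> \<nu> F) (open_supersets_at_bot X F)" if "closedin X F" for F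
    using \<nu> that unfolding signed_topological_measure_def by simp
  have le: "\<bar>\<nu> K\<bar> \<le> signed_topological_measure_norm X \<nu>" if "compactin X K" for K
    unfolding signed_topological_measure_norm_def by (rule SUP_upper) (simp add: that)
  have "0 \<le> signed_topological_measure_norm X \<nu>"
    by (rule order_trans[OF _ le[OF compactin_empty]]) simp
  then obtain B where B: "signed_topological_measure_norm X \<nu> = ereal B"
    using norm by (cases "signed_topological_measure_norm X \<nu>") auto
  have cpt: "- ereal B \<le> \<nu> K \<and> \<nu> K \<le> ereal B" if "compactin X K" for K
    using le[OF that] unfolding B by (cases "\<nu> K") auto
  have opn: "- ereal B \<le> \<nu> U \<and> \<nu> U \<le> ereal B" if U: "openin X U" for U
  proof
    have ev: "eventually (compactin X) (compact_subsets_at_top X U)"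
      unfolding eventually_compact_subsets_at_top by (intro exI[of _ "{}"]) simp
    have ne: "compact_subsets_at_top X U \<noteq> bot"
      unfolding trivial_limit_def eventually_compact_subsets_at_top by auto
    show "- ereal B \<le> \<nu> U"
      by (rule tendsto_lowerbound[OF inner[OF U] _ ne]) (use ev cpt in \<open>auto elim: eventually_mono\<close>)
    show "\<nu> U \<le> ereal B"
      by (rule tendsto_upperbound[OF inner[OF U] _ ne]) (use ev cpt in \<open>auto elim: eventually_mono\<close>)
  qed
  have cls: "- ereal B \<le> \<nu> F \<and> \<nu> F \<le> ereal B" if F: "closedin X F" for F
  proof
    note FS = closedin_subset[OF F]
    have ev: "eventually (openin X) (open_supersets_at_bot X F)"
      unfolding eventually_open_supersets_at_bot[OF FS] using FS by (intro exI[of _ "topspace X"]) simp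
    have ne: "open_supersets_at_bot X F \<noteq> bot"
      unfolding trivial_limit_def eventually_open_supersets_at_bot[OF FS] by auto
    show "- ereal B \<le> \<nu> F"
      by (rule tendsto_lowerbound[OF outer[OF F] _ ne]) (use ev opn in \<open>auto elim: eventually_mono\<close>)
    show "\<nu> F \<le> ereal B"
      by (rule tendsto_upperbound[OF outer[OF F] _ ne]) (use ev opn in \<open>auto elim: eventually_mono\<close>)
  qed
  have fin: "\<nu> A = ereal (?r A)" if "- ereal B \<le> \<nu> A \<and> \<nu> A \<le> ereal B" for A
    using that by (cases "\<nu> A") auto
  show oc: "\<nu> A = ereal (?r A)" if "open_or_closed_in X A" for A
    using that opn cls unfolding open_or_closed_in_def by (intro fin) auto
  have okc: "\<nu> A = ereal (?r A)" if "open_or_compact_in X A" for A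
    using that opn cpt unfolding open_or_compact_in_def by (intro fin) auto
  show "finite_signed_topological_measure X ?r"
  proof
    show "Hausdorff_space X" by (rule H)
    show "?r (A \<union> B) = ?r A + ?r B"
      if "open_or_compact_in X A" "open_or_compact_in X B" "open_or_compact_in X (A \<union> B)" "disjnt A B" for A B
    proof -
      have "ereal (?r (A \<union> B)) = ereal (?r A) + ereal (?r B)"
        using add[OF that] okc[OF that(1)] okc[OF that(2)] okc[OF that(3)] by simp
      then show ?thesis by simp
    qed
    show "\<exists>K. compactin X K \<and> K \<subseteq> U \<and> (\<forall>L. compactin X L \<and> K \<subseteq> L \<and> L \<subseteq> U \<longrightarrow> \<bar>?r L - ?r U\<bar> < e)"
      if U: "openin X U" and e: "0 < e" for U e
    proof -
      have "\<nu> U = ereal (?r U)" using okc[of U] U by (simp add: open_or_compact_in_def)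
      then have "(?r \<longlongrightarrow> ?r U) (compact_subsets_at_top X U)"
        using lim_real_of_ereal[of \<nu> "?r U"] inner[OF U] by simp
      then have "eventually (\<lambda>L. dist (?r L) (?r U) < e) (compact_subsets_at_top X U)"
        using e by (rule tendstoD)
      then show ?thesis unfolding eventually_compact_subsets_at_top dist_real_def .
    qed
    show "\<exists>U. openin X U \<and> F \<subseteq> U \<and> (\<forall>V. openin X V \<and> F \<subseteq> V \<and> V \<subseteq> U \<longrightarrow> \<bar>?r V - ?r F\<bar> < e)"
      if F: "closedin X F" and e: "0 < e" for F e
    proof -
      have "\<nu> F = ereal (?r F)" using oc[of F] F by (simp add: open_or_closed_in_def)
      then have "(?r \<longlongrightarrow> ?r F) (open_supersets_at_bot X F)"
        using lim_real_of_ereal[of \<nu> "?r F"] outer[OF F] by simp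
      then have "eventually (\<lambda>L. dist (?r L) (?r F) < e) (open_supersets_at_bot X F)"
        using e by (rule tendstoD)
      then show ?thesis
        unfolding eventually_open_supersets_at_bot[OF closedin_subset[OF F]] dist_real_def .
    qed
    show "\<exists>B. \<forall>K. compactin X K \<longrightarrow> \<bar>?r K\<bar> \<le> B"
    proof (intro exI[of _ B] allI impI)
      fix K assume K: "compactin X K"
      show "\<bar>?r K\<bar> \<le> B" using cpt[OF K] by (cases "\<nu> K") auto
    qed
  qed
qed

theorem theorem43:
  fixes X :: "'a topology" and \<nu> :: "'a set \<Rightarrow> ereal"
  assumes "connected_space X"
    and "locally_connected_space X"
    and "locally_compact_space X"
    and "Hausdorff_space X"
    and "\<not> compact_space X"
    and "genus_zero (Alexandroff_compactification X)"
    and "signed_topological_measure X \<nu>"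
    and "signed_topological_measure_norm X \<nu> < \<infinity>"
  shows "\<exists>\<nu>\<^sub>1 \<nu>\<^sub>2. topological_measure X \<nu>\<^sub>1 \<and> topological_measure X \<nu>\<^sub>2 \<and>
           (\<forall>A. openin X A \<or> closedin X A \<longrightarrow>
              \<not> (\<nu>\<^sub>1 A = \<infinity> \<and> \<nu>\<^sub>2 A = \<infinity>) \<and> \<nu> A = \<nu>\<^sub>1 A - \<nu>\<^sub>2 A)"
proof -
  let ?r = "\<lambda>A. real_of_ereal (\<nu> A)"
  note real = signed_topological_measure_finite[OF assms(4,7,8)]
  have Y: "genus_zero_space (Alexandroff_compactification X)"
  proof
    show "connected_space (Alexandroff_compactification X)"
      by (rule connected_space_Alexandroff_compactification_noncompact[OF assms(1,5)])
    show "locally_connected_space (Alexandroff_compactification X)"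
      by (rule locally_connected_space_Alexandroff_compactification[OF assms(1-5)])
  qed (use assms in \<open>simp_all add: Hausdorff_space_Alexandroff_compactification\<close>)
  have "signed_pair X ?r"
    by (intro signed_pair.intro compactified_signed_measure.intro real(1) Y
        finite_signed_topological_measure.negative[OF real(1)])
  then interpret signed_pair X ?r .
  show ?thesis
  proof (intro exI conjI allI impI)
    show "topological_measure X (\<lambda>A. ereal (P.extension A))"
      by (rule P.topological_measure_extension)
    show "topological_measure X (\<lambda>A. ereal (N.extension A))"
      by (rule N.topological_measure_extension)
    fix A assume "openin X A \<or> closedin X A"
    then have A: "open_or_closed_in X A" by (simp add: open_or_closed_in_def)
    show "\<not> (ereal (P.extension A) = \<infinity> \<and> ereal (N.extension A) = \<infinity>)" by simp
    have "\<nu> A = ereal (?r A)" by (rule real(2)[OF A])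
    also have "?r A = P.extension A - N.extension A" by (rule extension_difference[OF A])
    finally show "\<nu> A = ereal (P.extension A) - ereal (N.extension A)" by simp
  qed
qed

end
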